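(* The simple groups $PSp(4,3)$ and $PSL(3,4)$ satisfy $$I_2(PSp(4,3)) = 315 = I_2(PSL(3,4)),$$ but $|PSp(4,3)| = 25920$ and $|PSL(3,4)| = 20160$. Consequently, the assertion "if two simple groups have the same number of involutions, then they are of the same order" is false.
   Context: For a finite group $G$, $I_2(G)$ denotes the number of involutions of $G$, i.e. the number of elements of $G$ of order exactly $2$. $PSp(4,3)$ is the projective symplectic group in dimension $4$ over the field $\mathbb{F}_3$ with $3$ elements (the quotient of $Sp(4,3)$, the group of $4\times 4$ matrices over $\mathbb{F}_3$ preserving a nondegenerate alternating bilinear form, by its center). $PSL(3,4)$ is the projective special linear group in dimension $3$ over the field $\mathbb{F}_4$ with $4$ elements (the quotient of $SL(3,4)$ by its center). *)

theory Defs
  imports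
    "HOL-Analysis.Analysis"
    "HOL-Algebra.Algebra"
    "HOL-Library.Z2"
    "Berlekamp_Zassenhaus.Finite_Field"
begin

section \<open>The field with three elements\<close>

text \<open>
  The library type \<^typ>\<open>'a mod_ring\<close> is the ring of integers modulo the cardinality of \<open>'a\<close>,
  and a field if that cardinality is prime.  The numeral type \<open>3\<close> is built from a type
  constructor and cannot be made an instance of the class \<open>prime_card\<close>, hence the separate
  three-element type.
\<close>

datatype three = Three_0 | Three_1 | Three_2

lemma UNIV_three: "(UNIV :: three set) = {Three_0, Three_1, Three_2}"
  using three.exhaust by auto

instance three :: finite
  by standard (simp add: UNIV_three)

lemma CARD_three [simp]: "CARD(three) = 3"
  by (simp add: UNIV_three)

instance three :: prime_card
  by standard simp

type_synonym gf3 = "three mod_ring"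

lemma CARD_gf3: "CARD(gf3) = 3"
  by simp


section \<open>The field with four elements\<close>

text \<open>
  \<open>GF4 a b\<close> is the element \<open>a + b * w\<close> of \<open>F_2[w]\<close>, where \<open>w * w = w + 1\<close>.
\<close>

datatype gf4 = GF4 bit bit

lemma UNIV_gf4: "(UNIV :: gf4 set) = {GF4 0 0, GF4 1 0, GF4 0 1, GF4 1 1}"
proof -
  have "x \<in> {GF4 0 0, GF4 1 0, GF4 0 1, GF4 1 1}" for x
  proof (cases x)
    case (GF4 a b)
    then show ?thesis by (cases a; cases b) auto
  qed
  then show ?thesis by blast
qed

instance gf4 :: finite
  by standard (simp add: UNIV_gf4)

lemma CARD_gf4: "CARD(gf4) = 4"
  by (simp add: UNIV_gf4)

instantiation gf4 :: field
begin

definition zero_gf4 :: gf4 where "0 = GF4 0 0"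

definition one_gf4 :: gf4 where "1 = GF4 1 0"

fun plus_gf4 :: "gf4 \<Rightarrow> gf4 \<Rightarrow> gf4" where
  "GF4 a b + GF4 c d = GF4 (a + c) (b + d)"

definition uminus_gf4 :: "gf4 \<Rightarrow> gf4" where "- x = (x :: gf4)"

definition minus_gf4 :: "gf4 \<Rightarrow> gf4 \<Rightarrow> gf4" where "x - y = x + (y :: gf4)"

fun times_gf4 :: "gf4 \<Rightarrow> gf4 \<Rightarrow> gf4" where
  "GF4 a b * GF4 c d = GF4 (a * c + b * d) (a * d + b * c + b * d)"

text \<open>Every nonzero \<open>x\<close> satisfies \<open>x * x * x = 1\<close>.\<close>

definition inverse_gf4 :: "gf4 \<Rightarrow> gf4" where "inverse x = x * (x :: gf4)"

definition divide_gf4 :: "gf4 \<Rightarrow> gf4 \<Rightarrow> gf4" where "x div y = x * inverse (y :: gf4)"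

instance
proof
  fix x y z :: gf4
  obtain a b c d e f where [simp]: "x = GF4 a b" "y = GF4 c d" "z = GF4 e f"
    by (meson gf4.exhaust)
  show "x + y + z = x + (y + z)" 
    by (cases a; cases b; cases c; cases d; cases e; cases f) simp_all
  show "x + y = y + x" by (cases a; cases b; cases c; cases d) simp_all
  show "0 + x = x" by (simp add: zero_gf4_def)
  show "- x + x = 0" by (simp add: zero_gf4_def uminus_gf4_def)
  show "x - y = x + - y" by (simp add: minus_gf4_def uminus_gf4_def)
  show "x * y * z = x * (y * z)"
    by (cases a; cases b; cases c; cases d; cases e; cases f) simp_all
  show "x * y = y * x" by (cases a; cases b; cases c; cases d) simp_all
  show "1 * x = x" by (simp add: one_gf4_def)
  show "(x + y) * z = x * z + y * z"
    by (cases a; cases b; cases c; cases d; cases e; cases f) simp_all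
  show "0 \<noteq> (1 :: gf4)" by (simp add: zero_gf4_def one_gf4_def)
  show "x \<noteq> 0 \<Longrightarrow> inverse x * x = 1"
    by (cases a; cases b) (simp_all add: zero_gf4_def one_gf4_def inverse_gf4_def)
  show "x div y = x * inverse y" by (simp add: divide_gf4_def)
  show "inverse 0 = (0 :: gf4)" by (simp add: inverse_gf4_def zero_gf4_def)
qed

end


section \<open>Projective special linear groups\<close>

definition group_center :: "('a, 'b) monoid_scheme \<Rightarrow> 'a set" where
  "group_center G = {z \<in> carrier G. \<forall>g \<in> carrier G. z \<otimes>\<^bsub>G\<^esub> g = g \<otimes>\<^bsub>G\<^esub> z}"

definition SL :: "('k::field^'n^'n) monoid" where
  "SL = \<lparr>carrier = {A. det A = 1}, monoid.mult = (**), one = mat 1\<rparr>"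

definition PSL :: "('k::field^'n^'n) set monoid" where
  "PSL = SL Mod group_center SL"


section \<open>Projective symplectic groups\<close>

definition bilinear_form :: "('k::field^'n \<Rightarrow> 'k^'n \<Rightarrow> 'k) \<Rightarrow> bool" where
  "bilinear_form B \<longleftrightarrow>
     (\<forall>x. Vector_Spaces.linear (*s) (*) (\<lambda>y. B x y)) \<and>
     (\<forall>y. Vector_Spaces.linear (*s) (*) (\<lambda>x. B x y))"

definition alternating_form :: "('k::field^'n \<Rightarrow> 'k^'n \<Rightarrow> 'k) \<Rightarrow> bool" where
  "alternating_form B \<longleftrightarrow> (\<forall>x. B x x = 0)"

definition nondegenerate_form :: "('k::field^'n \<Rightarrow> 'k^'n \<Rightarrow> 'k) \<Rightarrow> bool" where
  "nondegenerate_form B \<longleftrightarrow>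
     (\<forall>x. (\<forall>y. B x y = 0) \<longrightarrow> x = 0) \<and> (\<forall>y. (\<forall>x. B x y = 0) \<longrightarrow> y = 0)"

definition Sp :: "('k::field^'n \<Rightarrow> 'k^'n \<Rightarrow> 'k) \<Rightarrow> ('k^'n^'n) monoid" where
  "Sp B = \<lparr>carrier = {A. \<forall>x y. B (A *v x) (A *v y) = B x y}, monoid.mult = (**), one = mat 1\<rparr>"

definition PSp :: "('k::field^'n \<Rightarrow> 'k^'n \<Rightarrow> 'k) \<Rightarrow> ('k^'n^'n) set monoid" where
  "PSp B = Sp B Mod group_center (Sp B)"

text \<open>
  All nondegenerate alternating bilinear forms on a four-dimensional space are equivalent, so
  \<open>Sp B\<close> does not depend on the choice of such a form \<open>B\<close>, up to conjugation in the general
  linear group.  The standard choice is the following one.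
\<close>

definition symplectic_form4 :: "'k::field^4 \<Rightarrow> 'k^4 \<Rightarrow> 'k" where
  "symplectic_form4 x y = x$1 * y$3 + x$2 * y$4 - x$3 * y$1 - x$4 * y$2"

lemma bilinear_symplectic_form4: "bilinear_form (symplectic_form4 :: 'k::field^4 \<Rightarrow> _)"
proof -
  have vs: "vector_space ((*s) :: 'k \<Rightarrow> 'k^4 \<Rightarrow> 'k^4)" "vector_space ((*) :: 'k \<Rightarrow> 'k \<Rightarrow> 'k)"
    by (simp_all add: vector_space_def algebra_simps)
  show ?thesis
    by (simp add: bilinear_form_def symplectic_form4_def Vector_Spaces.linear_iff vs algebra_simps)
qed

lemma alternating_symplectic_form4: "alternating_form (symplectic_form4 :: 'k::field^4 \<Rightarrow> _)"
  by (simp add: alternating_form_def symplectic_form4_def algebra_simps)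

lemma nondegenerate_symplectic_form4:
  "nondegenerate_form (symplectic_form4 :: 'k::field^4 \<Rightarrow> _)"
proof -
  have "x = 0" if "\<forall>y. symplectic_form4 x y = 0 \<or> symplectic_form4 y x = 0" for x :: "'k^4"
    using that[rule_format, of "axis 1 1"] that[rule_format, of "axis 2 1"]
      that[rule_format, of "axis 3 1"] that[rule_format, of "axis 4 1"]
    by (auto simp: symplectic_form4_def axis_def vec_eq_iff forall_4)
  then show ?thesis
    unfolding nondegenerate_form_def by blast
qed


section \<open>Involutions\<close>

definition I2 :: "('a, 'b) monoid_scheme \<Rightarrow> nat" where
  "I2 G = card {x \<in> carrier G. group.ord G x = 2}"

end

theory Submission
  imports Defs
begin

text \<open>
  Both groups are quotients \<open>G/Z\<close> of a matrix group by its centre, and the same three questions are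
  answered for \<open>G = SL(3,K)\<close> and \<open>G = Sp(4,K)\<close>.

  Simplicity.  A normal subgroup of \<open>G/Z\<close> is the image of a normal subgroup of \<open>G\<close>, so it is enough
  that a normal subgroup \<open>N\<close> of \<open>G\<close> that is not central is all of \<open>G\<close>.  In \<open>SL(3,K)\<close> two commutators
  with an elementary matrix turn a non-scalar element of \<open>N\<close>, up to conjugation, into a transvection; the
  conjugates of a transvection generate \<open>SL(3,K)\<close> (\<open>SL3_normal_subgroup\<close>).  In \<open>Sp(4,K)\<close>,
  characteristic not two, commutators with transvections show that all transvections with the same
  scalar are congruent modulo \<open>N\<close>.  Since transvections generate the group, \<open>G/N\<close> is covered by one
  abelian group of transvections, so \<open>N\<close> contains all commutators; and transvections are commutators
  (\<open>Sp_normal_subgroup\<close>).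

  Order.  Let \<open>e1\<close>, \<open>e2\<close>, ... be the standard basis.  \<open>SL(3,K)\<close> is fibred
  over the nonzero vectors by the first column, and \<open>Sp(4,K)\<close> over the hyperbolic pairs, i.e. the
  pairs \<open>(v, w)\<close> on which the form has the value \<open>1\<close>, by the images of \<open>e1\<close> and \<open>e3\<close>.  Both
  groups are transitive on these sets, so all fibres have the size of the fibre over the standard
  element, which is computed from the order of \<open>SL(2,K)\<close>.

  Involutions.  The involutions of \<open>G/Z\<close> are the cosets of the \<open>x\<close> outside \<open>Z\<close> with \<open>x * x\<close> in \<open>Z\<close>.
  In \<open>SL(3,4)\<close> the centre has order three, and \<open>x\<close> becomes an involution of \<open>SL(3,4)\<close> after cubing;
  in characteristic two these are the matrices \<open>1 + N\<close> with \<open>N * N = 0\<close>, \<open>N \<noteq> 0\<close>, in dimension three the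
  products \<open>v w\<^sup>T\<close> with \<open>w\<^sup>T v = 0\<close>, of which there are \<open>63 * 15 / 3 = 315\<close>.  In \<open>Sp(4,3)\<close> the centre is
  \<open>{1, -1}\<close>, and the elements of square \<open>1\<close> (90 outside the centre) and of square \<open>-1\<close> (540) are counted
  by counting the pairs of such an element with an adapted hyperbolic pair in two ways;
  \<open>(90 + 540) / 2 = 315\<close>.
\<close>

section \<open>Counting by fibres, and quotient groups\<close>

lemma card_eq_mult_card_fibres:
  assumes "finite A" "finite B" "\<And>a. a \<in> A \<Longrightarrow> f a \<in> B"
    and "\<And>b. b \<in> B \<Longrightarrow> card {a \<in> A. f a = b} = k"
  shows "card A = k * card B"
proof -
  have "card {b \<in> B. f a = b} = 1" if "a \<in> A" for a
  proof -
    have "{b \<in> B. f a = b} = {f a}" using assms(3)[OF that] by auto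
    then show ?thesis by simp
  qed
  then have "(\<Sum>a\<in>A. card {b \<in> B. f a = b}) = card A" by simp
  moreover have "(\<Sum>a\<in>A. card {b \<in> B. f a = b}) = k * card B"
    by (rule sum_multicount) (use assms in auto)
  ultimately show ?thesis by simp
qed

lemma (in group) group_center_normal: "group_center G \<lhd> G"
proof (rule normal_invI)
  have inv: "inv z \<otimes> g = g \<otimes> inv z"
    if "z \<in> carrier G" "\<forall>g\<in>carrier G. z \<otimes> g = g \<otimes> z" "g \<in> carrier G" for z g
  proof -
    have "inv z \<otimes> g = inv z \<otimes> (g \<otimes> z) \<otimes> inv z" using that(1,3) by (simp add: m_assoc)
    also have "\<dots> = inv z \<otimes> (z \<otimes> g) \<otimes> inv z" using that by simp
    also have "\<dots> = g \<otimes> inv z" using that(1,3) by (simp flip: m_assoc)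
    finally show ?thesis .
  qed
  have mult: "x \<otimes> y \<otimes> g = g \<otimes> (x \<otimes> y)"
    if "x \<in> carrier G" "y \<in> carrier G" "g \<in> carrier G"
      "\<forall>g\<in>carrier G. x \<otimes> g = g \<otimes> x" "\<forall>g\<in>carrier G. y \<otimes> g = g \<otimes> y" for x y g
  proof -
    have "x \<otimes> y \<otimes> g = x \<otimes> (y \<otimes> g)" using that(1-3) by (simp add: m_assoc)
    also have "\<dots> = x \<otimes> (g \<otimes> y)" using that(3,5) by simp
    also have "\<dots> = (x \<otimes> g) \<otimes> y" using that(1-3) by (simp add: m_assoc)
    also have "\<dots> = (g \<otimes> x) \<otimes> y" using that(3,4) by simp
    also have "\<dots> = g \<otimes> (x \<otimes> y)" using that(1-3) by (simp add: m_assoc)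
    finally show ?thesis .
  qed
  show "subgroup (group_center G) G"
  proof (rule subgroupI)
    show "group_center G \<noteq> {}" using one_closed by (fastforce simp: group_center_def)
    show "group_center G \<subseteq> carrier G" by (auto simp: group_center_def)
    show "inv z \<in> group_center G" if "z \<in> group_center G" for z
      using that inv unfolding group_center_def by blast
    show "x \<otimes> y \<in> group_center G" if "x \<in> group_center G" "y \<in> group_center G" for x y
      using that mult unfolding group_center_def by blast
  qed
  show "x \<otimes> h \<otimes> inv x \<in> group_center G" if "x \<in> carrier G" "h \<in> group_center G" for x h
  proof -
    have "x \<otimes> h = h \<otimes> x" "h \<in> carrier G" using that by (auto simp: group_center_def)
    then have "x \<otimes> h \<otimes> inv x = h" using that(1) by (simp add: m_assoc)
    then show ?thesis using that by simp
  qed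
qed

lemma (in group) ord_eq_2_iff:
  assumes "x \<in> carrier G"
  shows "ord x = 2 \<longleftrightarrow> x \<otimes> x = \<one> \<and> x \<noteq> \<one>"
proof
  assume "ord x = 2"
  then show "x \<otimes> x = \<one> \<and> x \<noteq> \<one>"
    using assms pow_ord_eq_1[OF assms] ord_eq_1[OF assms] by (auto simp: numeral_2_eq_2)
next
  assume *: "x \<otimes> x = \<one> \<and> x \<noteq> \<one>"
  then have "x [^] (2::nat) = \<one>" using assms by (simp add: numeral_2_eq_2)
  then have "ord x dvd 2" using assms pow_eq_id by simp
  moreover have "ord x \<noteq> 1" using * assms ord_eq_1 by simp
  ultimately show "ord x = 2"
    by (metis One_nat_def dvd_imp_le gcd_nat.extremum_uniqueI le_SucE le_zero_eq nat.distinct(1) numeral_2_eq_2 zero_less_Suc)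
qed

lemma (in normal) coset_eq_iff:
  assumes "x \<in> carrier G" "y \<in> carrier G"
  shows "H #> x = H #> y \<longleftrightarrow> x \<otimes> inv y \<in> H"
proof
  assume "H #> x = H #> y"
  then have "x \<in> H #> y" using rcos_self[OF assms(1) subgroup_axioms] by simp
  then obtain h where "h \<in> H" "x = h \<otimes> y" by (auto simp: r_coset_def)
  then show "x \<otimes> inv y \<in> H" using assms by (simp add: m_assoc)
next
  assume *: "x \<otimes> inv y \<in> H"
  have "x = (x \<otimes> inv y) \<otimes> y" using assms by (simp add: m_assoc)
  then have "x \<in> H #> y" using * by (auto simp: r_coset_def)
  then show "H #> x = H #> y"
    using repr_independence assms subgroup_axioms by metis
qed

lemma (in normal) coset_eq_self_iff:
  assumes "x \<in> carrier G"
  shows "H #> x = H \<longleftrightarrow> x \<in> H"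
  using assms coset_eq_iff[of x \<one>] by (simp add: subset)

text \<open>
  The last premise says that \<open>y\<close> is the conjugate of \<open>h\<close> by \<open>x\<close>, in a form without inverses.
\<close>

lemma (in normal) conj_mem:
  assumes "x \<in> carrier G" "h \<in> H" "y \<in> carrier G" "x \<otimes> h = y \<otimes> x"
  shows "y \<in> H"
proof -
  have "h \<in> carrier G" using assms(2) by (rule mem_carrier)
  have "x \<otimes> h \<otimes> inv x = y" using assms by (simp add: m_assoc)
  then show ?thesis using inv_op_closed2[OF assms(1,2)] by simp
qed

text \<open>
  The last premise says that \<open>c\<close> is the commutator of \<open>h\<close> and \<open>y\<close>, in a form without inverses,
  which for concrete matrices is checked by multiplying out.
\<close>

lemma (in normal) commutator_mem:
  assumes h: "h \<in> H" and y: "y \<in> carrier G" and c: "c \<in> carrier G" "c \<otimes> (y \<otimes> h) = h \<otimes> y"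
  shows "c \<in> H"
proof -
  have hG: "h \<in> carrier G" using h by (rule mem_carrier)
  have "c = h \<otimes> y \<otimes> inv (y \<otimes> h)"
    using c(1) hG y by (simp add: m_assoc flip: c(2))
  also have "\<dots> = h \<otimes> (y \<otimes> inv h \<otimes> inv y)" using hG y by (simp add: m_assoc inv_mult_group)
  finally show ?thesis
    using h y inv_op_closed2[OF y m_inv_closed[OF h]] subgroup.m_closed[OF subgroup_axioms h] by simp
qed

text \<open>
  The preimage of a normal subgroup of the quotient is normal and contains the kernel \<open>H\<close>.
\<close>

lemma (in normal) simple_FactGroup:
  assumes fin: "finite (carrier G)" and proper: "H \<noteq> carrier G"
    and max: "\<And>N. N \<lhd> G \<Longrightarrow> N \<subseteq> H \<or> N = carrier G"
  shows "simple_group (G Mod H)"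
proof -
  interpret Q: group "G Mod H" by (rule factorgroup_is_group)
  have car: "carrier (G Mod H) = (\<lambda>x. H #> x) ` carrier G" by (simp add: carrier_FactGroup)
  have hom: "(\<lambda>x. H #> x) \<in> hom G (G Mod H)" by (rule r_coset_hom_Mod)
  interpret h: group_hom G "G Mod H" "\<lambda>x. H #> x" by unfold_locales (rule hom)
  show ?thesis
  proof
    obtain g where g: "g \<in> carrier G" "g \<notin> H" using proper subset by auto
    have "{H #> \<one>, H #> g} \<subseteq> carrier (G Mod H)" unfolding car using g by blast
    moreover have "H #> \<one> \<noteq> H #> g" using g coset_eq_self_iff[of g] by (simp add: subset)
    moreover have "finite (carrier (G Mod H))" using fin car by simp
    ultimately show "1 < order (G Mod H)"
      unfolding order_def using card_mono[of "carrier (G Mod H)" "{H #> \<one>, H #> g}"] by simp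
  next
    fix M assume "M \<lhd> G Mod H"
    then interpret M: normal M "G Mod H" .
    define N where "N = {x \<in> carrier G. H #> x \<in> M}"
    have "N \<lhd> G"
    proof (rule normal_invI)
      show "subgroup N G"
        by (rule subgroupI)
          (use M.one_closed subset M.m_closed M.m_inv_closed
            in \<open>auto simp: N_def h.hom_inv h.hom_mult simp del: mult_FactGroup one_FactGroup intro: exI[of _ \<one>]\<close>)
      show "x \<otimes> n \<otimes> inv x \<in> N" if "x \<in> carrier G" "n \<in> N" for x n
        using that M.inv_op_closed2[of "H #> x" "H #> n"] car by (auto simp: N_def)
    qed
    then consider "N \<subseteq> H" | "N = carrier G" using max by blast
    then show "M = carrier (G Mod H) \<or> M = {\<one>\<^bsub>G Mod H\<^esub>}"
    proof cases
      case 1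
      have "C = H" if C: "C \<in> M" for C
      proof -
        obtain x where x: "x \<in> carrier G" "C = H #> x" using C M.subset car by auto
        then have "x \<in> N" using C by (simp add: N_def)
        then show "C = H" using 1 x coset_eq_self_iff by blast
      qed
      then have "M \<subseteq> {H}" by blast
      moreover have "H \<in> M" using M.one_closed by simp
      ultimately have "M = {H}" by blast
      then show ?thesis by simp
    next
      case 2
      then have "carrier (G Mod H) \<subseteq> M" unfolding car by (auto simp: N_def)
      then show ?thesis using M.subset by auto
    qed
  qed
qed

lemma (in normal) order_FactGroup: "order (G Mod H) * card H = order G"
  using lagrange[OF subgroup_axioms] by (simp add: order_def FactGroup_def)

lemma (in normal) I2_FactGroup:
  "I2 (G Mod H) = card {C \<in> carrier (G Mod H). C \<noteq> H \<and> set_mult G C C = H}"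
proof -
  interpret Q: group "G Mod H" by (rule factorgroup_is_group)
  show ?thesis unfolding I2_def by (rule arg_cong[where f=card], rule Collect_cong, rule conj_cong[OF refl]) (subst Q.ord_eq_2_iff, auto)
qed

text \<open>
  The coset map sends the elements on the left onto the involutions of the quotient, and its
  fibres are cosets of \<open>H\<close>.
\<close>

lemma (in normal) I2_FactGroup_mult:
  assumes fin: "finite (carrier G)"
  shows "card {x \<in> carrier G. x \<notin> H \<and> x \<otimes> x \<in> H} = card H * I2 (G Mod H)"
  unfolding I2_FactGroup
proof (rule card_eq_mult_card_fibres[where f="\<lambda>x. H #> x"])
  show "finite {x \<in> carrier G. x \<notin> H \<and> x \<otimes> x \<in> H}" using fin by simp
  show "finite {C \<in> carrier (G Mod H). C \<noteq> H \<and> set_mult G C C = H}" using fin by (simp add: carrier_FactGroup)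
  show "H #> x \<in> {C \<in> carrier (G Mod H). C \<noteq> H \<and> set_mult G C C = H}"
    if "x \<in> {x \<in> carrier G. x \<notin> H \<and> x \<otimes> x \<in> H}" for x
    using that by (auto simp: carrier_FactGroup rcos_sum coset_eq_self_iff)
  fix C assume "C \<in> {C \<in> carrier (G Mod H). C \<noteq> H \<and> set_mult G C C = H}"
  then have C: "C \<in> carrier (G Mod H)" "C \<noteq> H" "set_mult G C C = H" by auto
  from C(1) obtain g where "g \<in> carrier G" "C = H #> g" by (auto simp: carrier_FactGroup)
  with C have g: "g \<in> carrier G" "C = H #> g" "g \<notin> H" "g \<otimes> g \<in> H"
    using coset_eq_self_iff[of g] coset_eq_self_iff[of "g \<otimes> g"] by (auto simp: rcos_sum)
  have cosetD: "x \<in> carrier G \<and> H #> x = C" if "x \<in> H #> g" for x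
    using that g repr_independence[OF that g(1) subgroup_axioms] r_coset_subset_G[OF subset g(1)] by auto
  have "x \<notin> H \<and> x \<otimes> x \<in> H" if "x \<in> carrier G" "H #> x = C" for x
  proof -
    have "H #> (x \<otimes> x) = H" using that C by (simp flip: rcos_sum)
    then show ?thesis using that C coset_eq_self_iff[of x] coset_eq_self_iff[of "x \<otimes> x"] by auto
  qed
  moreover have "x \<in> H #> g" if "x \<in> carrier G" "H #> x = C" for x
    using that g rcos_self[OF that(1) subgroup_axioms] by simp
  ultimately have "{x \<in> {x \<in> carrier G. x \<notin> H \<and> x \<otimes> x \<in> H}. H #> x = C} = H #> g"
    using cosetD by blast
  then show "card {x \<in> {x \<in> carrier G. x \<notin> H \<and> x \<otimes> x \<in> H}. H #> x = C} = card H"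
    using card_rcosets_equal[of "H #> g" H] g subset by (simp add: rcosetsI)
qed

text \<open>
  The statement about groups with natural numbers as elements is reached by relabelling.
\<close>

lemma (in simple_group) nat_copy:
  assumes fin: "finite (carrier G)"
  obtains G' :: "nat monoid" where "simple_group G'" "finite (carrier G')"
    "I2 G' = I2 G" "order G' = order G"
proof -
  obtain f :: "'a \<Rightarrow> nat" where f: "inj_on f (carrier G)"
    using fin finite_imp_inj_to_nat_seg by metis
  define G' where "G' = image_group f G"
  have iso: "f \<in> iso G G'" unfolding G'_def by (rule inj_imp_image_group_iso[OF f])
  interpret G': group G' unfolding G'_def by (rule inj_imp_image_group_is_group[OF f])
  interpret h: group_hom G G' f using iso by unfold_locales (simp add: iso_def)
  have bij: "bij_betw f (carrier G) (carrier G')" using iso by (simp add: iso_def)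
  have o: "G'.ord (f x) = 2 \<longleftrightarrow> ord x = 2" if "x \<in> carrier G" for x
  proof -
    have "f (x \<otimes> x) = f \<one> \<longleftrightarrow> x \<otimes> x = \<one>" "f x = f \<one> \<longleftrightarrow> x = \<one>"
      using that by (simp_all only: inj_on_eq_iff[OF f] m_closed one_closed)
    then show ?thesis using that by (simp add: G'.ord_eq_2_iff ord_eq_2_iff)
  qed
  have "bij_betw f {x \<in> carrier G. ord x = 2} {y \<in> carrier G'. G'.ord y = 2}"
  proof (rule bij_betw_subset[OF bij])
    show "f ` {x \<in> carrier G. ord x = 2} = {y \<in> carrier G'. G'.ord y = 2}"
      unfolding bij_betw_imp_surj_on[OF bij, symmetric] using o by auto
  qed auto
  then have "I2 G' = I2 G" unfolding I2_def by (rule bij_betw_same_card[symmetric])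
  moreover have "simple_group G'" by (rule iso_simple[OF G'.group_axioms iso])
  moreover have "finite (carrier G')" "order G' = order G"
    using fin bij_betw_finite[OF bij] bij_betw_same_card[OF bij] unfolding order_def by (blast, metis)
  ultimately show ?thesis using that by blast
qed

text \<open>
  The quotient by \<open>H\<close> is an image of \<open>A\<close>, hence abelian.
\<close>

lemma (in normal) commutator_mem_if_abelian_supplement:
  assumes A: "A \<subseteq> carrier G" and com: "\<And>a b. a \<in> A \<Longrightarrow> b \<in> A \<Longrightarrow> a \<otimes> b = b \<otimes> a"
    and sup: "set_mult G H A = carrier G"
    and x: "x \<in> carrier G" and y: "y \<in> carrier G"
  shows "x \<otimes> y \<otimes> inv (y \<otimes> x) \<in> H"
proof -
  have *: "\<exists>a\<in>A. H #> x = H #> a" if "x \<in> carrier G" for x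
  proof -
    have "x \<in> set_mult G H A" using that sup by simp
    then obtain h a where ha: "h \<in> H" "a \<in> A" "x = h \<otimes> a"
      unfolding set_mult_def by blast
    moreover have "a \<in> carrier G" "h \<in> carrier G" using ha A subset by auto
    ultimately have "x \<otimes> inv a \<in> H" by (simp add: m_assoc)
    with ha have "H #> x = H #> a"
      using coset_eq_iff[OF that \<open>a \<in> carrier G\<close>] by simp
    then show ?thesis using ha by blast
  qed
  obtain a b where ab: "a \<in> A" "b \<in> A" "H #> x = H #> a" "H #> y = H #> b"
    using *[OF x] *[OF y] by blast
  then have abG: "a \<in> carrier G" "b \<in> carrier G" using A by auto
  have "H #> (x \<otimes> y) = H #> (a \<otimes> b)"
    using x y abG by (simp only: ab(3,4) flip: rcos_sum)
  also have "\<dots> = H #> (b \<otimes> a)" using com ab(1,2) by simp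
  also have "\<dots> = H #> (y \<otimes> x)"
    using x y abG by (simp only: ab(3,4) flip: rcos_sum)
  finally show ?thesis using x y by (simp add: coset_eq_iff)
qed

section \<open>Matrices over a field\<close>

text \<open>
  The fibres of a nonzero linear functional are translates of each other.
\<close>

lemma card_linear_functional_fibre:
  fixes f :: "'k::{field,finite}^'n \<Rightarrow> 'k"
  assumes add: "\<And>x y. f (x + y) = f x + f y" and scale: "\<And>c x. f (c *s x) = c * f x"
    and nz: "f y0 \<noteq> 0"
  shows "card {y. f y = c} * CARD('k) = CARD('k) ^ CARD('n)"
proof -
  define d where "d = (\<lambda>c. (c / f y0) *s y0)"
  have fd: "f (d c) = c" for c using nz by (simp add: d_def scale)
  have eq: "card {y. f y = c} = card {y. f y = 0}" for c
  proof (rule bij_betw_same_card)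
    show "bij_betw (\<lambda>y. y + d (- c)) {y. f y = c} {y. f y = 0}"
      by (rule bij_betw_byWitness[where f'="\<lambda>y. y - d (- c)"])
        (auto simp: add fd add[of _ "- d (- c)", simplified] scale[of "-1" "d (-c)", simplified])
  qed
  have "card (UNIV :: ('k^'n) set) = card {y. f y = 0} * card (UNIV :: 'k set)"
    by (rule card_eq_mult_card_fibres[where f=f]) (auto intro: eq)
  then show ?thesis using eq[of c] by simp
qed

lemma card_SL2_row:
  assumes "a \<noteq> 0 \<or> b \<noteq> (0 :: 'k::{field,finite})"
  shows "card {(c, d). a * d - b * c = (1 :: 'k)} = CARD('k)"
proof (cases "a = 0")
  case False
  then have "bij_betw fst {(c, d). a * d - b * c = 1} UNIV"
    by (intro bij_betw_byWitness[where f'="\<lambda>c. (c, (1 + b * c) / a)"]) (auto simp: field_simps)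
  then show ?thesis by (rule bij_betw_same_card)
next
  case True
  then have "b \<noteq> 0" using assms by simp
  then have "bij_betw snd {(c, d). a * d - b * c = 1} UNIV"
    using True by (intro bij_betw_byWitness[where f'="\<lambda>d. (- 1 / b, d)"])
      (auto simp: field_simps, metis minus_minus)
  then show ?thesis by (rule bij_betw_same_card)
qed

text \<open>
  Each nonzero first row has \<open>q\<close> completions; a quadruple stands for the matrix with rows
  \<open>(a, b)\<close> and \<open>(c, d)\<close>.
\<close>

lemma card_SL2:
  "card {(a, b, c, d). a * d - b * c = (1 :: 'k::{field,finite})} = CARD('k) * (CARD('k) ^ 2 - 1)"
proof -
  let ?S = "{(a, b, c, d). a * d - b * c = (1 :: 'k)}"
  let ?B = "UNIV - {(0, 0)} :: ('k \<times> 'k) set"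
  have "card ?S = CARD('k) * card ?B"
  proof (rule card_eq_mult_card_fibres[where f="\<lambda>(a, b, c, d). (a, b)"])
    fix p assume "p \<in> ?B"
    then obtain a b where p: "p = (a, b)" "a \<noteq> 0 \<or> b \<noteq> 0" by (cases p) auto
    have "{x \<in> ?S. (case x of (a, b, c, d) \<Rightarrow> (a, b)) = p}
        = (\<lambda>(c, d). (a, b, c, d)) ` {(c, d). a * d - b * c = 1}"
      using p by (auto simp: image_iff)
    then show "card {x \<in> ?S. (case x of (a, b, c, d) \<Rightarrow> (a, b)) = p} = CARD('k)"
      using card_SL2_row[OF p(2)] by (simp add: card_image inj_on_def split_def prod_eq_iff)
  qed auto
  then show ?thesis by (simp add: card_Diff_subset power2_eq_square)
qed

lemma mat_mult_commute: "mat c ** A = A ** mat (c :: 'k::comm_semiring_1)"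
  by (simp add: vec_eq_iff matrix_matrix_mult_def mat_def if_distrib[of "\<lambda>x. x * _"]
      if_distrib[of "\<lambda>x. _ * x"] mult.commute cong: if_cong)

lemma mat_mult_nth: "(mat c ** A) $ i $ j = (c :: 'k::semiring_1) * A $ i $ j"
  by (simp add: matrix_matrix_mult_def mat_def if_distrib[of "\<lambda>x. x * _"] cong: if_cong)

lemma mat_mult_mat: "mat a ** mat b = (mat (a * b) :: 'k::semiring_1^'n^'n)"
  by (simp add: vec_eq_iff mat_mult_nth) (simp add: mat_def)

lemma mat_vec: "mat c *v x = (c :: 'k::semiring_1) *s x"
  by (simp add: vec_eq_iff matrix_vector_mult_def mat_def if_distrib[of "\<lambda>x. x * _"] cong: if_cong)

lemma mat_inj: "(mat c :: 'k::semiring_1^'n^'n) = mat d \<longleftrightarrow> c = d"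
  by (auto simp: vec_eq_iff mat_def)

lemma matrix_axis_nth: "(A *v axis j (1 :: 'k::semiring_1)) $ i = A $ i $ j"
  by (simp add: matrix_vector_mult_def axis_def if_distrib[of "\<lambda>x. _ * x"] cong: if_cong)

text \<open>
  Comparing the eigenvalues of two basis vectors with the eigenvalue of their sum.
\<close>

lemma scalar_if_all_eigenvectors:
  fixes A :: "'k::field^'n^'n"
  assumes "\<And>v. \<exists>c. A *v v = c *s v"
  shows "\<exists>c. A = mat c"
proof -
  obtain c where c: "A *v axis i 1 = c i *s axis i 1" for i
    using choice[of "\<lambda>i c. A *v axis i 1 = c *s axis i 1"] assms by auto
  have A: "A $ i $ j = (if i = j then c j else 0)" for i j
    using arg_cong[OF c[of j], of "\<lambda>v. v $ i"] by (simp add: matrix_axis_nth) (simp add: axis_def)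
  have "c i = c j" if "i \<noteq> j" for i j
  proof -
    obtain d where d: "A *v (axis i 1 + axis j 1) = d *s (axis i 1 + axis j 1)" using assms by blast
    have "c i = d" using arg_cong[OF d, of "\<lambda>v. v $ i"] that
      by (simp add: matrix_vector_right_distrib matrix_axis_nth A) (simp add: axis_def)
    moreover have "c j = d" using arg_cong[OF d, of "\<lambda>v. v $ j"] that
      by (simp add: matrix_vector_right_distrib matrix_axis_nth A) (simp add: axis_def)
    ultimately show ?thesis by simp
  qed
  then have "A = mat (c i)" for i by (simp add: vec_eq_iff A mat_def) metis
  then show ?thesis by blast
qed

section \<open>Normal subgroups of the special linear group in dimension three\<close>

lemma carrier_SL [simp]: "carrier SL = {A. det A = 1}"
  and mult_SL [simp]: "mult SL = (**)"
  and one_SL [simp]: "one SL = mat 1"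
  by (simp_all add: SL_def)

lemma group_SL: "group (SL :: ('k::field^'n^'n) monoid)"
proof (rule groupI)
  fix A :: "'k^'n^'n" assume "A \<in> carrier SL"
  then have A: "det A = 1" by simp
  then have "invertible A" by (simp add: invertible_det_nz)
  then obtain B where B: "B ** A = mat 1" unfolding invertible_def by blast
  then have "det B * det A = 1" by (metis det_mul det_I)
  then show "\<exists>B\<in>carrier SL. B \<otimes>\<^bsub>SL\<^esub> A = \<one>\<^bsub>SL\<^esub>" using A B by auto
qed (auto simp: det_mul matrix_mul_assoc)

text \<open>
  Explicit entries make products, determinants and equations between matrices a matter of
  simplification.
\<close>

definition mat3 :: "'k \<Rightarrow> 'k \<Rightarrow> 'k \<Rightarrow> 'k \<Rightarrow> 'k \<Rightarrow> 'k \<Rightarrow> 'k \<Rightarrow> 'k \<Rightarrow> 'k \<Rightarrow> 'k::comm_ring_1^3^3" where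
  "mat3 a b c d e f g h i = vector [vector [a, b, c], vector [d, e, f], vector [g, h, i]]"

lemma mat3_nth [simp]:
  "mat3 a b c d e f g h i $ 1 = vector [a, b, c]"
  "mat3 a b c d e f g h i $ 2 = vector [d, e, f]"
  "mat3 a b c d e f g h i $ 3 = vector [g, h, i]"
  by (simp_all add: mat3_def)

lemma mat3_eq_iff [simp]:
  "mat3 a b c d e f g h i = mat3 a' b' c' d' e' f' g' h' i' \<longleftrightarrow>
    a = a' \<and> b = b' \<and> c = c' \<and> d = d' \<and> e = e' \<and> f = f' \<and> g = g' \<and> h = h' \<and> i = i'"
  by (auto simp: vec_eq_iff[where 'b=3] forall_3)

lemma mat3_cases: obtains a b c d e f g h i where "A = mat3 a b c d e f g h i"
proof
  show "A = mat3 (A$1$1) (A$1$2) (A$1$3) (A$2$1) (A$2$2) (A$2$3) (A$3$1) (A$3$2) (A$3$3)"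
    by (simp add: vec_eq_iff[where 'b=3] forall_3)
qed

lemma mat3_mult [simp]:
  "mat3 a b c d e f g h i ** mat3 a' b' c' d' e' f' g' h' i' =
    mat3 (a * a' + b * d' + c * g') (a * b' + b * e' + c * h') (a * c' + b * f' + c * i')
       (d * a' + e * d' + f * g') (d * b' + e * e' + f * h') (d * c' + e * f' + f * i')
       (g * a' + h * d' + i * g') (g * b' + h * e' + i * h') (g * c' + h * f' + i * i')"
  by (simp add: vec_eq_iff[where 'b=3] forall_3 matrix_matrix_mult_def sum_3)

lemma mat3_vec [simp]:
  "mat3 a b c d e f g h i *v x =
    vector [a * x$1 + b * x$2 + c * x$3, d * x$1 + e * x$2 + f * x$3, g * x$1 + h * x$2 + i * x$3]"
  by (simp add: vec_eq_iff[where 'b=3] forall_3 matrix_vector_mult_def sum_3)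

lemma mat3_det [simp]:
  "det (mat3 a b c d e f g h i) = a * (e * i - f * h) - b * (d * i - f * g) + c * (d * h - e * g)"
  by (simp add: det_3 algebra_simps)

lemma mat3_mat: "mat c = mat3 c 0 0 0 c 0 0 0 c"
  by (simp add: vec_eq_iff[where 'b=3] forall_3 mat_def)

text \<open>
  Commuting with three elementary matrices already makes a matrix scalar.
\<close>

lemma group_center_SL3:
  "group_center (SL :: ('k::field^3^3) monoid) = mat ` {c. c ^ 3 = 1}"
proof safe
  fix A :: "'k^3^3" assume A: "A \<in> group_center SL"
  obtain a b c d e f g h i where eq: "A = mat3 a b c d e f g h i" by (rule mat3_cases)
  have com: "A ** B = B ** A" if "det B = 1" for B using A that by (auto simp: group_center_def)
  have "A = mat a"
    using com[of "mat3 1 1 0 0 1 0 0 0 1"] com[of "mat3 1 0 0 0 1 1 0 0 1"] com[of "mat3 1 0 0 0 1 0 1 0 1"]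
    by (auto simp: eq mat3_mat)
  moreover from this have "a ^ 3 = 1"
    using A by (simp add: group_center_def mat3_mat power3_eq_cube mult.assoc)
  ultimately show "A \<in> mat ` {c. c ^ 3 = 1}" by blast
next
  fix c :: 'k assume "c ^ 3 = 1"
  then have "det (mat c :: 'k^3^3) = 1" by (simp add: mat3_mat power3_eq_cube mult.assoc)
  then show "(mat c :: 'k^3^3) \<in> group_center SL" by (simp add: group_center_def mat_mult_commute)
qed

text \<open>
  The determinant of the matrix with columns \<open>v\<close>, \<open>w\<close>, \<open>x\<close> is the scalar product of \<open>x\<close> with
  the cross product of \<open>v\<close> and \<open>w\<close>, which is nonzero for independent \<open>v\<close> and \<open>w\<close>.
\<close>

lemma SL3_column_basis:
  fixes v w :: "'k::field^3"
  assumes "v \<noteq> 0" "\<And>c. w \<noteq> c *s v"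
  obtains P :: "'k^3^3" where "det P = 1" "P *v axis 1 1 = v" "P *v axis 2 1 = w"
proof -
  define n1 n2 n3 where n: "n1 = v$2 * w$3 - v$3 * w$2" "n2 = v$3 * w$1 - v$1 * w$3"
    "n3 = v$1 * w$2 - v$2 * w$1"
  have "n1 \<noteq> 0 \<or> n2 \<noteq> 0 \<or> n3 \<noteq> 0"
  proof (rule ccontr)
    assume "\<not> ?thesis"
    then have 0: "v$2 * w$3 = v$3 * w$2" "v$3 * w$1 = v$1 * w$3" "v$1 * w$2 = v$2 * w$1"
      by (auto simp: n)
    obtain i where i: "v $ i \<noteq> 0" using \<open>v \<noteq> 0\<close> by (auto simp: vec_eq_iff)
    have "w = (w $ i / v $ i) *s v"
      using 0 i exhaust_3[of i] by (auto simp: vec_eq_iff forall_3 field_simps)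
    then show False using assms(2) by blast
  qed
  moreover have "P *v axis 1 1 = v \<and> P *v axis 2 1 = w"
    if "P = mat3 (v$1) (w$1) x (v$2) (w$2) y (v$3) (w$3) z" for P x y z
    by (simp add: that vec_eq_iff forall_3 axis_def)
  moreover have "det (mat3 (v$1) (w$1) x (v$2) (w$2) y (v$3) (w$3) z) = x * n1 + y * n2 + z * n3" for x y z
    by (simp add: n algebra_simps)
  ultimately show ?thesis
    using that[of "mat3 (v$1) (w$1) (1 / n1) (v$2) (w$2) 0 (v$3) (w$3) 0"]
      that[of "mat3 (v$1) (w$1) 0 (v$2) (w$2) (1 / n2) (v$3) (w$3) 0"]
      that[of "mat3 (v$1) (w$1) 0 (v$2) (w$2) 0 (v$3) (w$3) (1 / n3)"]
    by (metis (no_types, lifting) add.right_neutral add_0 mult_zero_left nonzero_divide_eq_eq)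
qed

text \<open>
  Gaussian elimination. The inverse of an elementary matrix is elementary, so a matrix lies in
  \<open>H\<close> as soon as one that is obtained from it by row or column operations does.
\<close>

lemma SL3_generated_by_elementary:
  fixes A :: "'k::field^3^3"
  assumes mult: "\<And>A B. A \<in> H \<Longrightarrow> B \<in> H \<Longrightarrow> A ** B \<in> H"
    and E: "\<And>t. mat3 1 t 0 0 1 0 0 0 1 \<in> H" "\<And>t. mat3 1 0 t 0 1 0 0 0 1 \<in> H"
      "\<And>t. mat3 1 0 0 t 1 0 0 0 1 \<in> H" "\<And>t. mat3 1 0 0 0 1 t 0 0 1 \<in> H"
      "\<And>t. mat3 1 0 0 0 1 0 t 0 1 \<in> H" "\<And>t. mat3 1 0 0 0 1 0 0 t 1 \<in> H"
    and "det A = 1"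
  shows "A \<in> H"
proof -
  obtain a b c d e f g h i where A: "A = mat3 a b c d e f g h i" by (rule mat3_cases)
  note left = mult[OF E(1), of "mat3 _ _ _ _ _ _ _ _ _"] mult[OF E(2), of "mat3 _ _ _ _ _ _ _ _ _"]
    mult[OF E(3), of "mat3 _ _ _ _ _ _ _ _ _"] mult[OF E(4), of "mat3 _ _ _ _ _ _ _ _ _"]
    mult[OF E(5), of "mat3 _ _ _ _ _ _ _ _ _"] mult[OF E(6), of "mat3 _ _ _ _ _ _ _ _ _"]
  have step4: "mat3 1 0 0 0 1 f 0 0 i \<in> H" if "i = 1" for f i
    using E(4)[of f] that by simp
  have step3: "mat3 1 0 0 0 e f 0 h i \<in> H" if "h \<noteq> 0" "e * i - f * h = 1" for e f h i
  proof -
    \<comment> \<open>adding a multiple of the third row turns the second one into \<open>(0, 1, ?f)\<close>; then \<open>i - ?f * h = 1\<close>\<close>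
    let ?f = "f + (1 - e) / h * i"
    have hf: "h * ?f + 1 = i" using that by (simp add: field_simps)
    have "mat3 1 0 0 0 1 ?f 0 0 1 \<in> H" by (rule step4) simp
    from left(6)[OF this, of h] have "mat3 1 0 0 0 1 ?f 0 h i \<in> H" by (simp add: hf del: times_divide_eq_left)
    from left(4)[OF this, of "- ((1 - e) / h)"] show ?thesis using that by simp
  qed
  have step2: "mat3 1 b c 0 e f 0 h i \<in> H" if det: "e * i - f * h = 1" for b c e f h i
  proof -
    have "mat3 1 0 0 0 e f 0 h i \<in> H"
    proof (cases "h = 0")
      case True
      then have "e \<noteq> 0" using det by auto
      then have "mat3 1 0 0 0 e f 0 e (f + i) \<in> H"
        using det True by (intro step3) (auto simp: algebra_simps)
      from left(6)[OF this, of "- 1"] show ?thesis using True by simp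
    qed (use det step3 in auto)
    have "mat3 1 0 0 0 e f 0 h i ** (mat3 1 b 0 0 1 0 0 0 1 ** mat3 1 0 c 0 1 0 0 0 1) \<in> H"
      using mult[OF \<open>mat3 1 0 0 0 e f 0 h i \<in> H\<close> mult[OF E(1)[of b] E(2)[of c]]] by simp
    then show ?thesis by simp
  qed
  have step1: "mat3 1 b c d e f g h i \<in> H" if "det (mat3 1 b c d e f g h i) = 1" for b c d e f g h i
  proof -
    have "mat3 1 b c 0 (e - d * b) (f - d * c) 0 (h - g * b) (i - g * c) \<in> H"
      using that by (intro step2) (simp add: algebra_simps)
    from left(5)[OF left(3)[OF this, of d, simplified], of g] show ?thesis by simp
  qed
  have step0: "mat3 a b c d e f g h i \<in> H"
    if "det (mat3 a b c d e f g h i) = 1" "d \<noteq> 0 \<or> g \<noteq> 0" for a b c d e f g h i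
  proof (cases "d = 0")
    case False
    define k where "k = (1 - a) / d"
    have k: "a + k * d = 1" using False by (simp add: k_def)
    have "det (mat3 (a + k * d) (b + k * e) (c + k * f) d e f g h i) = det (mat3 a b c d e f g h i)"
      by (simp add: algebra_simps)
    then have "mat3 (a + k * d) (b + k * e) (c + k * f) d e f g h i \<in> H"
      using that unfolding k by (intro step1) simp
    from left(1)[OF this, of "- k"] show ?thesis by (simp add: algebra_simps)
  next
    case True
    then have g: "g \<noteq> 0" using that by simp
    define k where "k = (1 - a) / g"
    have k: "a + k * g = 1" using g by (simp add: k_def)
    have "det (mat3 (a + k * g) (b + k * h) (c + k * i) d e f g h i) = det (mat3 a b c d e f g h i)"
      by (simp add: algebra_simps)
    then have "mat3 (a + k * g) (b + k * h) (c + k * i) d e f g h i \<in> H"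
      using that unfolding k by (intro step1) simp
    from left(2)[OF this, of "- k"] show ?thesis by (simp add: algebra_simps)
  qed
  show ?thesis
  proof (cases "d = 0 \<and> g = 0")
    case True
    then have "mat3 a b c a (b + e) (c + f) g h i \<in> H"
      using assms(8) A by (intro step0) (auto simp: algebra_simps)
    from left(3)[OF this, of "- 1"] show ?thesis using A True by simp
  next
    case False
    then show ?thesis using step0 assms(8) A by blast
  qed
qed

text \<open>
  Let \<open>g\<close> in \<open>N\<close> map \<open>e1\<close> to \<open>e2\<close>. The commutator of \<open>g\<close> with \<open>E = 1 + e1 e3\<^sup>T\<close> has its
  difference to the identity concentrated in the plane of \<open>e1\<close> and \<open>e2\<close>; it is a transvection
  already, or its commutator with \<open>E\<close> is one.
\<close>

theorem SL3_normal_subgroup: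
  assumes N: "N \<lhd> (SL :: ('k::field^3^3) monoid)" and nc: "\<not> N \<subseteq> group_center SL"
  shows "N = carrier SL"
proof -
  interpret normal N "SL :: ('k^3^3) monoid" by (rule N)
  have conj: "Y \<in> N" if "U \<in> N" "det P = 1" "det Y = 1" "P ** U = Y ** P" for U Y P
    using conj_mem[of P U Y] that by simp
  have mult: "U ** Y \<in> N" if "U \<in> N" "Y \<in> N" for U Y
    using subgroup.m_closed[OF subgroup_axioms that] by simp
  have comm: "C \<in> N" if "U \<in> N" "det Y = 1" "det C = 1" "C ** (Y ** U) = U ** Y" for U Y C
    using commutator_mem[of U Y C] that by simp
  \<comment> \<open>some element of \<open>N\<close> moves a line, and up to conjugation it maps \<open>e1\<close> to \<open>e2\<close>\<close>
  obtain A where A: "A \<in> N" "A \<notin> group_center SL" using nc by blast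
  then have dA: "det A = 1" using mem_carrier by auto
  have "\<exists>v. \<forall>c. A *v v \<noteq> c *s v"
  proof (rule ccontr)
    assume "\<not> ?thesis"
    then have "\<exists>c. A = mat c" by (intro scalar_if_all_eigenvectors) auto
    then obtain c where c: "A = mat c" by blast
    then have "c ^ 3 = 1" using dA by (simp add: mat3_mat power3_eq_cube mult.assoc)
    then show False using A(2) c by (simp add: group_center_SL3)
  qed
  then obtain v where v: "\<And>c. A *v v \<noteq> c *s v" by blast
  then have "v \<noteq> 0" by (metis matrix_vector_mult_0_right vector_smult_lzero)
  then obtain P where P: "det P = 1" "P *v axis 1 1 = v" "P *v axis 2 1 = A *v v"
    using v SL3_column_basis[of v "A *v v"] by blast
  obtain P' where P': "det P' = 1" "P ** P' = mat 1" "P' ** P = mat 1"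
    using inv_closed[of P] r_inv[of P] l_inv[of P] P(1) by auto
  define g where "g = P' ** A ** P"
  have gN: "g \<in> N"
    by (rule conj[OF A(1) P'(1)])
      (auto simp: g_def det_mul P P' dA matrix_mul_assoc[symmetric])
  have "P *v (g *v axis 1 1) = (P ** P') *v (A *v (P *v axis 1 1))"
    by (simp add: g_def matrix_vector_mul_assoc matrix_mul_assoc)
  also have "\<dots> = P *v axis 2 1" by (simp add: P P')
  finally have "P' *v (P *v (g *v axis 1 1)) = P' *v (P *v axis 2 1)" by simp
  then have g1: "g *v axis 1 1 = axis 2 1"
    by (simp add: matrix_vector_mul_assoc matrix_mul_assoc P')
  obtain a b c d e f a' b' c' where g0: "g = mat3 a' a b b' c d c' e f" by (rule mat3_cases)
  have g: "g = mat3 0 a b 1 c d 0 e f"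
    using g1 g0 by (simp add: vec_eq_iff forall_3 axis_def)
  have "det g = 1" using gN mem_carrier by auto
  then have det: "b * e - a * f = 1" by (simp add: g algebra_simps)
  \<comment> \<open>the last row of the inverse of \<open>g\<close> is \<open>(e, 0, - a)\<close>, so \<open>g\<close> conjugates \<open>1 + e1 e3\<^sup>T\<close> to \<open>1 + e2 (e, 0, - a)\<close>\<close>
  have C1: "mat3 1 0 (- 1) e 1 (- a - e) 0 0 1 \<in> N"
    by (rule comm[OF gN, of "mat3 1 0 1 0 1 0 0 0 1"])
      (use det in \<open>auto simp: g algebra_simps\<close>)
  have "\<exists>p q. mat3 1 0 p 0 1 q 0 0 1 \<in> N \<and> (p \<noteq> 0 \<or> q \<noteq> 0)"
  proof (cases "e = 0")
    case True
    then show ?thesis using C1 by (intro exI[of _ "- 1"] exI[of _ "- a"]) simp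
  next
    case False
    have "mat3 1 0 0 0 1 e 0 0 1 \<in> N"
      by (rule comm[OF C1, of "mat3 1 0 1 0 1 0 0 0 1"]) (auto simp: algebra_simps)
    then show ?thesis using False by blast
  qed
  then obtain p q where pq: "mat3 1 0 p 0 1 q 0 0 1 \<in> N" "p \<noteq> 0 \<or> q \<noteq> 0" by blast
  \<comment> \<open>\<open>SL(2,K)\<close> is transitive on the nonzero vectors \<open>(p, q)\<close>; the case distinctions provide the matrices\<close>
  have tr: "mat3 1 0 s 0 1 t 0 0 1 \<in> N" if "s \<noteq> 0 \<or> t \<noteq> 0" for s t
  proof -
    have first: "mat3 1 0 1 0 1 0 0 0 1 \<in> N"
    proof (cases "p = 0")
      case True
      then show ?thesis using pq
        by (intro conj[OF pq(1), of "mat3 0 (1 / q) 0 (- q) 0 0 0 0 1"]) (auto simp: field_simps)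
    next
      case False
      then show ?thesis using pq
        by (intro conj[OF pq(1), of "mat3 (1 / p) 0 0 (- q) p 0 0 0 1"]) (auto simp: field_simps)
    qed
    show ?thesis
    proof (cases "s = 0")
      case True
      then show ?thesis using that
        by (intro conj[OF first, of "mat3 0 (- 1 / t) 0 t 0 0 0 0 1"]) (auto simp: field_simps)
    next
      case False
      then show ?thesis
        by (intro conj[OF first, of "mat3 s 0 0 t (1 / s) 0 0 0 1"]) (auto simp: field_simps)
    qed
  qed
  have one: "mat3 1 0 0 0 1 0 0 0 1 \<in> N" using subgroup.one_closed[OF subgroup_axioms] by (simp add: mat3_mat)
  have E13: "mat3 1 0 t 0 1 0 0 0 1 \<in> N" for t using tr[of t 0] one by (cases "t = 0") auto
  have E23: "mat3 1 0 0 0 1 t 0 0 1 \<in> N" for t using tr[of 0 t] one by (cases "t = 0") auto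
  let ?R = "mat3 0 0 1 1 0 0 0 1 0"
  \<comment> \<open>conjugation by the cyclic permutation of the basis gives the other positions\<close>
  have E21: "mat3 1 0 0 t 1 0 0 0 1 \<in> N" for t by (rule conj[OF E13[of t], of ?R]) auto
  have E31: "mat3 1 0 0 0 1 0 t 0 1 \<in> N" for t by (rule conj[OF E23[of t], of ?R]) auto
  have E32: "mat3 1 0 0 0 1 0 0 t 1 \<in> N" for t by (rule conj[OF E21[of t], of ?R]) auto
  have E12: "mat3 1 t 0 0 1 0 0 0 1 \<in> N" for t by (rule conj[OF E31[of t], of ?R]) auto
  have "B \<in> N" if "det B = 1" for B
    by (rule SL3_generated_by_elementary[OF mult E12 E13 E21 E23 E31 E32 that])
  then show ?thesis using subset by auto
qed

section \<open>The order of SL(3,q), and matrices of square zero\<close>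

lemma SL3_transitive:
  fixes v :: "'k::field^3"
  assumes "v \<noteq> 0"
  obtains P :: "'k^3^3" where "det P = 1" "P *v axis 1 1 = v"
proof -
  have "\<exists>w. \<forall>c. w \<noteq> c *s v"
  proof (cases "v $ 1 = 0")
    case True
    then show ?thesis by (intro exI[of _ "axis 1 1"]) (auto simp: vec_eq_iff axis_def)
  next
    case False
    then show ?thesis by (intro exI[of _ "axis 2 1"]) (auto simp: vec_eq_iff axis_def forall_3)
  qed
  then obtain w where "\<And>c. w \<noteq> c *s v" by blast
  then show ?thesis using SL3_column_basis[OF assms] that by blast
qed

text \<open>
  Over the first column \<open>e1\<close> the rest of the first row is arbitrary and the lower right block
  lies in \<open>SL(2,q)\<close>.
\<close>

lemma card_SL3:
  "card {A :: 'k::{field,finite}^3^3. det A = 1} =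
    CARD('k) ^ 3 * (CARD('k) ^ 2 - 1) * (CARD('k) ^ 3 - 1)"
proof -
  let ?S = "{A :: 'k^3^3. det A = 1}" and ?e = "axis 1 1 :: 'k^3"
  let ?F = "\<lambda>v. {A \<in> ?S. A *v ?e = v}"
  have "?F ?e = (\<lambda>((x, y), (a, b, c, d)). mat3 1 x y 0 a b 0 c d) `
      (UNIV \<times> {(a, b, c, d). a * d - b * c = 1})" (is "_ = ?f ` ?D")
  proof safe
    fix A :: "'k^3^3" assume A: "det A = 1" "A *v ?e = ?e"
    obtain a x y z b c z' d e where M: "A = mat3 a x y z b c z' d e" by (rule mat3_cases)
    have eq: "A = mat3 1 x y 0 b c 0 d e" using A(2) unfolding M by (simp add: vec_eq_iff forall_3 axis_def)
    then show "A \<in> ?f ` ?D" using A(1) by (auto intro!: image_eqI[of _ _ "((x, y), (b, c, d, e))"])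
  qed (auto simp: vec_eq_iff forall_3 axis_def)
  moreover have "inj_on ?f ?D" by (auto simp: inj_on_def)
  ultimately have base: "card (?F ?e) = CARD('k) ^ 2 * (CARD('k) * (CARD('k) ^ 2 - 1))"
    by (simp add: card_image card_cartesian_product card_SL2 power2_eq_square)
  have "card ?S = (CARD('k) ^ 2 * (CARD('k) * (CARD('k) ^ 2 - 1))) * card (UNIV - {0 :: 'k^3})"
  proof (rule card_eq_mult_card_fibres[where f="\<lambda>A. A *v ?e"])
    fix A :: "'k^3^3" assume "A \<in> ?S"
    then obtain B where "B ** A = mat 1" using invertible_det_nz[of A] unfolding invertible_def by auto
    then have "B *v (A *v ?e) = ?e" by (simp add: matrix_vector_mul_assoc)
    moreover have "?e \<noteq> 0" by simp
    ultimately have "A *v ?e \<noteq> 0" by (metis matrix_vector_mult_0_right)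
    then show "A *v ?e \<in> UNIV - {0}" by simp
  next
    fix v :: "'k^3" assume "v \<in> UNIV - {0}"
    then obtain P :: "'k^3^3" where P: "det P = 1" "P *v ?e = v" using SL3_transitive[of v] by auto
    then obtain Q where Q: "Q ** P = mat 1" "P ** Q = mat 1"
      using invertible_det_nz[of P] unfolding invertible_def by auto
    have "det Q * det P = 1" using Q(1) by (metis det_mul det_I)
    then have dQ: "det Q = 1" using P by simp
    have "Q *v v = ?e" using Q(1) by (simp add: P(2)[symmetric] matrix_vector_mul_assoc)
    then have "bij_betw ((**) P) (?F ?e) (?F v)"
      using P dQ Q
      by (intro bij_betw_byWitness[where f'="(**) Q"])
        (auto simp: matrix_mul_assoc det_mul simp flip: matrix_vector_mul_assoc)
    then show "card (?F v) = CARD('k) ^ 2 * (CARD('k) * (CARD('k) ^ 2 - 1))"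
      using base bij_betw_same_card by fastforce
  qed auto
  then show ?thesis by (simp add: card_Diff_subset power2_eq_square power3_eq_cube)
qed

definition outer :: "'k::times^'n \<Rightarrow> 'k^'m \<Rightarrow> 'k^'m^'n" where
  "outer v w = (\<chi> i j. v $ i * w $ j)"

definition dot :: "'k::comm_ring_1^'n \<Rightarrow> 'k^'n \<Rightarrow> 'k" where
  "dot v w = (\<Sum>i\<in>UNIV. v $ i * w $ i)"

lemma outer_vec: "outer v w *v x = dot w x *s v"
  by (simp add: vec_eq_iff outer_def dot_def matrix_vector_mult_def sum_distrib_right sum_distrib_left mult_ac)

lemma outer_mult: "outer v w ** outer v' w' = outer v (dot w v' *s w')"
  by (simp add: vec_eq_iff outer_def dot_def matrix_matrix_mult_def sum_distrib_right sum_distrib_left mult_ac)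

lemma outer_eq_0_iff: "outer v w = 0 \<longleftrightarrow> v = 0 \<or> w = (0 :: 'k::field^_)"
  by (auto simp: vec_eq_iff outer_def)

lemma vec3_expand:
  fixes A :: "'k::field^3^'m"
  shows "A *v x = x$1 *s (A *v axis 1 1) + x$2 *s (A *v axis 2 1) + x$3 *s (A *v axis 3 1)"
  by (simp add: vec_eq_iff matrix_axis_nth) (simp add: matrix_vector_mult_def sum_3 mult.commute)

text \<open>
  If \<open>v = N u \<noteq> 0\<close>, then \<open>u\<close> and \<open>v\<close> are independent. Extending them by \<open>z\<close> to a basis
  and expanding \<open>N (N z) = 0\<close> shows that \<open>N z\<close>, too, is a multiple of \<open>v\<close>.
\<close>

lemma square_zero_imp_outer:
  fixes N :: "'k::field^3^3"
  assumes "N ** N = 0" "N \<noteq> 0"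
  obtains v w where "v \<noteq> 0" "w \<noteq> 0" "dot w v = 0" "N = outer v w"
proof -
  have NN: "N *v (N *v x) = 0" for x by (simp add: matrix_vector_mul_assoc assms)
  obtain u where u: "N *v u \<noteq> 0"
    using assms(2) by (metis matrix_eq matrix_vector_mult_0)
  define v where "v = N *v u"
  have v: "v \<noteq> 0" "N *v v = 0" using u NN by (auto simp: v_def)
  have indep: "v \<noteq> c *s u" for c
  proof
    assume c: "v = c *s u"
    then have "N *v v = c *s v" by (simp add: v_def vector_scalar_commute)
    then show False using v c by auto
  qed
  have "u \<noteq> 0" using u by auto
  from SL3_column_basis[OF this indep]
  obtain P where P: "det P = 1" "P *v axis 1 1 = u" "P *v axis 2 1 = v" by blast
  then obtain Q where Q: "P ** Q = mat 1"
    using invertible_det_nz[of P] unfolding invertible_def by auto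
  define z where "z = P *v axis 3 1"
  have expand: "\<exists>a b c. x = a *s u + b *s v + c *s z" for x
  proof -
    have "x = P *v (Q *v x)" by (simp add: matrix_vector_mul_assoc Q)
    then show ?thesis using vec3_expand[of P "Q *v x"] P by (auto simp: z_def)
  qed
  have N: "N *v (a *s u + b *s v + c *s z) = a *s v + c *s (N *v z)" for a b c
    by (simp add: matrix_vector_right_distrib vector_scalar_commute v v_def[symmetric])
  have "\<exists>t. N *v z = t *s v"
  proof -
    obtain a b c where abc: "N *v z = a *s u + b *s v + c *s z" using expand by blast
    have 0: "a *s v + c *s (N *v z) = 0" using NN[of z] by (simp add: abc N)
    show ?thesis
    proof (cases "c = 0")
      case True
      then have "a = 0" using 0 v by simp
      then show ?thesis using abc True by auto
    next
      case False
      have "N *v z = (- a / c) *s v"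
        using 0 False by (simp add: vec_eq_iff field_simps add_eq_0_iff2 add_eq_0_iff)
      then show ?thesis by blast
    qed
  qed
  then obtain s where s: "N *v z = s *s v" by blast
  have "\<exists>t. N *v x = t *s v" for x
  proof -
    obtain a b c where x: "x = a *s u + b *s v + c *s z" using expand by blast
    have "N *v x = a *s v + c *s (s *s v)" unfolding x N s ..
    also have "\<dots> = (a + c * s) *s v" by (simp add: vec_eq_iff algebra_simps)
    finally show ?thesis by blast
  qed
  then obtain w where w: "N *v axis j 1 = w j *s v" for j
    using choice[of "\<lambda>j t. N *v axis j 1 = t *s v"] by auto
  have eq: "N = outer v (\<chi> j. w j)"
  proof -
    have "N $ i $ j = v $ i * w j" for i j
      using arg_cong[OF w[of j], of "\<lambda>x. x $ i"] by (simp add: matrix_axis_nth mult.commute)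
    then show ?thesis by (simp add: vec_eq_iff outer_def)
  qed
  moreover have "dot (\<chi> j. w j) v = 0"
    using v eq by (simp add: outer_vec)
  ultimately show ?thesis using that v assms(2) outer_eq_0_iff by metis
qed

lemma outer_eq_iff:
  assumes "v \<noteq> 0" "w \<noteq> 0"
  shows "outer v' w' = outer v (w :: 'k::field^_) \<longleftrightarrow> (\<exists>c. c \<noteq> 0 \<and> v' = c *s v \<and> w' = (1 / c) *s w)"
proof
  assume eq: "outer v' w' = outer v w"
  then have eq': "v' $ i * w' $ j = v $ i * w $ j" for i j by (simp add: outer_def vec_eq_iff)
  obtain i j where ij: "v $ i \<noteq> 0" "w $ j \<noteq> 0" using assms by (auto simp: vec_eq_iff)
  then have nz: "v' $ i \<noteq> 0" "w' $ j \<noteq> 0" using eq'[of i j] by auto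
  let ?c = "w $ j / w' $ j"
  have "v' = ?c *s v" using eq'[of _ j] nz by (simp add: vec_eq_iff field_simps)
  moreover have "w' = (1 / ?c) *s w"
  proof -
    have "w' $ k * w $ j = w $ k * w' $ j" for k
    proof -
      have "v $ i * (w' $ k * w $ j) = w' $ k * (v' $ i * w' $ j)" by (simp add: eq' mult_ac)
      also have "\<dots> = v $ i * (w $ k * w' $ j)" using eq'[of i k] by (simp add: mult_ac)
      finally show ?thesis using ij(1) by simp
    qed
    then show ?thesis using ij(2) by (simp add: vec_eq_iff field_simps)
  qed
  ultimately show "\<exists>c. c \<noteq> 0 \<and> v' = c *s v \<and> w' = (1 / c) *s w"
    using nz ij by (intro exI[of _ ?c]) auto
qed (auto simp: outer_def vec_eq_iff)

text \<open>
  The factors of \<open>outer v w\<close> are determined up to a common scalar, which accounts for the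
  factor \<open>q - 1\<close> on the left.
\<close>

lemma card_square_zero3:
  "card {N :: 'k::{field,finite}^3^3. N ** N = 0 \<and> N \<noteq> 0} * (CARD('k) - 1) =
    (CARD('k) ^ 2 - 1) * (CARD('k) ^ 3 - 1)"
proof -
  let ?X = "{N :: 'k^3^3. N ** N = 0 \<and> N \<noteq> 0}"
  let ?T = "{(v :: 'k^3, w). v \<noteq> 0 \<and> w \<noteq> 0 \<and> dot w v = 0}"
  have "card ?T = (CARD('k) ^ 2 - 1) * card (UNIV - {0 :: 'k^3})"
  proof (rule card_eq_mult_card_fibres[where f=fst])
    fix v :: "'k^3" assume "v \<in> UNIV - {0}"
    then obtain i where i: "v $ i \<noteq> 0" by (auto simp: vec_eq_iff)
    have "card {w. dot w v = 0} * CARD('k) = CARD('k) ^ CARD(3)"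
    proof (rule card_linear_functional_fibre)
      show "dot (axis i 1) v \<noteq> 0"
        using i by (simp add: dot_def axis_def if_distrib[of "\<lambda>x. x * _"] cong: if_cong)
    qed (auto simp: dot_def sum.distrib algebra_simps sum_distrib_left)
    then have "card {w. dot w v = 0} = CARD('k) ^ 2" by (simp add: power2_eq_square power3_eq_cube)
    moreover have "{p \<in> ?T. fst p = v} = Pair v ` ({w. dot w v = 0} - {0})"
      using i by (auto simp: image_iff)
    moreover have "(0 :: 'k^3) \<in> {w. dot w v = 0}" by (simp add: dot_def)
    ultimately show "card {p \<in> ?T. fst p = v} = CARD('k) ^ 2 - 1"
      by (simp add: card_image inj_on_def card_Diff_subset)
  qed auto
  moreover have "card ?T = (CARD('k) - 1) * card ?X"
  proof (rule card_eq_mult_card_fibres[where f="\<lambda>(v, w). outer v w"])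
    fix p assume "p \<in> ?T"
    then show "(case p of (v, w) \<Rightarrow> outer v w) \<in> ?X"
      by (auto simp: outer_mult outer_eq_0_iff)
  next
    fix N :: "'k^3^3" assume "N \<in> ?X"
    then obtain v w where vw: "v \<noteq> 0" "w \<noteq> 0" "dot w v = 0" "N = outer v w"
      using square_zero_imp_outer[of N] by auto
    have dotc: "dot (a *s w) (b *s v) = a * b * dot w v" for a b
      by (simp add: dot_def sum_distrib_left mult_ac)
    have "{p \<in> ?T. (case p of (v, w) \<Rightarrow> outer v w) = N} = (\<lambda>c. (c *s v, (1 / c) *s w)) ` (UNIV - {0})"
      using vw by (auto simp: outer_eq_iff dotc)
    moreover have "inj_on (\<lambda>c. (c *s v, (1 / c) *s w)) (UNIV - {0})"
      using vw by (auto simp: inj_on_def)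
    ultimately show "card {p \<in> ?T. (case p of (v, w) \<Rightarrow> outer v w) = N} = CARD('k) - 1"
      by (simp add: card_image card_Diff_subset)
  qed auto
  ultimately show ?thesis by (simp add: card_Diff_subset mult.commute)
qed

section \<open>The group PSL(3,4)\<close>

lemma scalar_mult_square:
  "(mat c ** A) ** (mat c ** A) = mat (c * c) ** (A ** (A :: 'k::comm_semiring_1^'n^'n))"
proof -
  have "(mat c ** A) ** (mat c ** A) = mat c ** (A ** mat c) ** A" by (simp only: matrix_mul_assoc)
  also have "A ** mat c = mat c ** A" by (rule mat_mult_commute[symmetric])
  also have "mat c ** (mat c ** A) ** A = (mat c ** mat c) ** (A ** A)" by (simp only: matrix_mul_assoc)
  finally show ?thesis by (simp only: mat_mult_mat)
qed

lemma gf4_cube: "c ^ 3 = 1 \<longleftrightarrow> c \<noteq> (0 :: gf4)"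
proof -
  have "c \<in> {GF4 0 0, GF4 1 0, GF4 0 1, GF4 1 1}" using UNIV_gf4 by auto
  then show ?thesis by (auto simp: power3_eq_cube zero_gf4_def one_gf4_def)
qed

lemma gf4_add_self: "a + a = (0 :: gf4)"
  by (cases a) (simp add: zero_gf4_def)

lemma gf4_two: "(2 :: gf4) = 0"
  using gf4_add_self[of 1] by (simp only: one_add_one)

lemma matrix_mult_add_left: "(A + B) ** C = A ** C + B ** (C :: 'k::semiring_1^_^_)"
  by (simp add: vec_eq_iff matrix_matrix_mult_def algebra_simps sum.distrib)

lemma gf4_square_eq_1: "a * a = 1 \<longleftrightarrow> a = (1 :: gf4)"
proof -
  have "a \<in> {GF4 0 0, GF4 1 0, GF4 0 1, GF4 1 1}" using UNIV_gf4 by auto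
  then show ?thesis by (auto simp: one_gf4_def)
qed

lemma center_SL3_gf4: "group_center (SL :: (gf4^3^3) monoid) = mat ` (UNIV - {0})"
  by (auto simp: group_center_SL3 gf4_cube)

lemma card_center_SL3_gf4: "card (group_center (SL :: (gf4^3^3) monoid)) = 3"
  by (simp add: center_SL3_gf4 card_image inj_on_def mat_inj card_Diff_subset CARD_gf4)

text \<open>
  The scalars in \<open>SL(3,4)\<close> are the cube roots of unity, i.e. all nonzero elements of the
  field. If \<open>A * A\<close> is a scalar \<open>c\<close>, then \<open>A\<close> cubed is \<open>c A\<close>, of square \<open>c\<close> cubed \<open>= 1\<close>; so
  cubing sends the elements to be counted to the involutions of \<open>SL(3,4)\<close>, three to one.
\<close>

lemma PSL3_gf4:
  "simple_group (PSL :: (gf4^3^3) set monoid)"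
  "order (PSL :: (gf4^3^3) set monoid) = 20160"
  "I2 (PSL :: (gf4^3^3) set monoid) = 315"
proof -
  let ?G = "SL :: (gf4^3^3) monoid" and ?Z = "group_center (SL :: (gf4^3^3) monoid)"
  interpret group ?G by (rule group_SL)
  interpret normal ?Z ?G by (rule group_center_normal)
  have fin: "finite (carrier ?G)" by simp
  have ord: "order ?G = 60480" using card_SL3[where 'k=gf4] by (simp add: order_def CARD_gf4)
  have "?Z \<noteq> carrier ?G" using ord card_center_SL3_gf4 by (metis order_def numeral_eq_iff num.distinct)
  then show "simple_group (PSL :: (gf4^3^3) set monoid)"
    unfolding PSL_def using SL3_normal_subgroup by (intro simple_FactGroup fin) auto
  show "order (PSL :: (gf4^3^3) set monoid) = 20160"
    using order_FactGroup by (simp add: ord card_center_SL3_gf4 PSL_def)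
  let ?X = "{A \<in> carrier ?G. A \<notin> ?Z \<and> A \<otimes>\<^bsub>?G\<^esub> A \<in> ?Z}"
  let ?Y = "{A :: gf4^3^3. A ** A = mat 1 \<and> A \<noteq> mat 1}"
  have "card ?Y = card {N :: gf4^3^3. N ** N = 0 \<and> N \<noteq> 0}"
  proof (rule bij_betw_same_card)
    have sq: "(mat 1 + N) ** (mat 1 + N) = mat 1 + N ** N" for N :: "gf4^3^3"
    proof -
      have "(mat 1 + N) ** (mat 1 + N) = mat 1 + (N + N) + N ** N"
        by (simp add: matrix_add_ldistrib matrix_mult_add_left)
      also have "N + N = 0" by (simp add: vec_eq_iff gf4_two)
      finally show ?thesis by simp
    qed
    have dbl: "mat 1 + (mat 1 + N) = N" for N :: "gf4^3^3"
      by (simp add: vec_eq_iff gf4_two flip: add.assoc)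
    have eq0: "mat 1 + N = 0 \<longleftrightarrow> N = mat 1" for N :: "gf4^3^3"
      by (metis dbl add.right_neutral)
    show "bij_betw ((+) (mat 1)) ?Y {N :: gf4^3^3. N ** N = 0 \<and> N \<noteq> 0}"
      by (rule bij_betw_byWitness[where f'="(+) (mat 1)"]) (auto simp: sq dbl eq0 dbl[of 0, simplified])
  qed
  then have Y: "card ?Y = 315" using card_square_zero3[where 'k=gf4] by (simp add: CARD_gf4)
  have "card ?X = 3 * card ?Y"
  proof (rule card_eq_mult_card_fibres[where f="\<lambda>A. A ** (A ** A)"])
    fix A assume "A \<in> ?X"
    then obtain c where A: "A \<notin> ?Z" "A ** A = mat c" "c \<noteq> 0" by (auto simp: center_SL3_gf4)
    have c3: "c * (c * c) = 1" using A(3) gf4_cube[of c] by (simp add: power3_eq_cube mult.assoc)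
    have cA: "A ** (A ** A) = mat c ** A" by (simp add: A mat_mult_commute)
    have "A = mat (c * c) ** (mat c ** A)"
      using c3 by (simp add: matrix_mul_assoc mat_mult_mat mult.assoc)
    then have ne: "mat c ** A \<noteq> mat 1" using A(1,3) by (auto simp: center_SL3_gf4 mat_mult_mat)
    have "(mat c ** A) ** (mat c ** A) = mat 1"
      by (simp add: scalar_mult_square A mat_mult_mat c3 mult.assoc)
    with ne show "A ** (A ** A) \<in> ?Y" by (simp add: cA)
  next
    fix B assume "B \<in> ?Y"
    then have B: "B ** B = mat 1" "B \<noteq> mat 1" by auto
    have "det B * det B = det (B ** B)" by (simp add: det_mul)
    then have dB: "det B = 1" by (simp add: B gf4_square_eq_1)
    have cc: "(mat c ** B) ** (mat c ** B) = mat (c * c)" for c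
      by (simp add: scalar_mult_square B)
    have c3: "c * (c * c) = 1" if "c \<noteq> 0" for c :: gf4
      using that gf4_cube[of c] by (simp add: power3_eq_cube mult.assoc)
    have cancel: "mat (c * c) ** (mat c ** D) = D" if "c \<noteq> 0" for c :: gf4 and D :: "gf4^3^3"
      using c3[OF that] by (simp add: matrix_mul_assoc mat_mult_mat mult.assoc)
    have nonscalar: "mat c ** B \<noteq> mat d" if "c \<noteq> 0" for c d
    proof
      assume "mat c ** B = mat d"
      then have e: "B = mat (c * c * d)" using cancel[OF that, of B] by (simp add: mat_mult_mat)
      then have "(c * c * d) * (c * c * d) = 1" using B(1) by (simp add: mat_mult_mat mat_inj)
      then have "c * c * d = 1" by (simp only: gf4_square_eq_1)
      then show False using e B(2) by simp
    qed
    \<comment> \<open>the elements whose cube is the involution \<open>B\<close> are its multiples by the nonzero scalars\<close>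
    have "{A \<in> ?X. A ** (A ** A) = B} = (\<lambda>c. mat c ** B) ` (UNIV - {0})"
    proof safe
      fix A :: "gf4^3^3" assume A: "A \<otimes>\<^bsub>?G\<^esub> A \<in> ?Z" "B = A ** (A ** A)"
      then obtain c where c: "c \<noteq> 0" "A ** A = mat c" by (auto simp: center_SL3_gf4)
      then have "A = mat (c * c) ** (A ** (A ** A))" using cancel[of c A] by (simp add: mat_mult_commute)
      then show "A \<in> (\<lambda>c. mat c ** (A ** (A ** A))) ` (UNIV - {0})" using c by auto
    next
      fix c :: gf4 assume c: "c \<noteq> 0"
      have "det (mat c :: gf4^3^3) = 1" using c3[OF c] by (simp add: mat3_mat mult.assoc)
      then show "mat c ** B \<in> carrier ?G" by (simp add: det_mul dB)
      show "(mat c ** B) \<otimes>\<^bsub>?G\<^esub> (mat c ** B) \<in> ?Z" using c by (simp add: cc center_SL3_gf4)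
      show False if "mat c ** B \<in> ?Z" using that nonscalar[OF c] by (auto simp: center_SL3_gf4)
      show "mat c ** B ** (mat c ** B ** (mat c ** B)) = B"
        using cancel[OF c, of B] unfolding cc mat_mult_commute[of "c * c"] by simp
    qed
    moreover have "inj_on (\<lambda>c. mat c ** B) (UNIV - {0})"
    proof (rule inj_onI)
      fix c d assume "mat c ** B = mat d ** B"
      then have "mat c ** (B ** B) = mat d ** (B ** B)" by (simp only: matrix_mul_assoc)
      then show "c = d" by (simp add: B mat_inj)
    qed
    ultimately show "card {A \<in> ?X. A ** (A ** A) = B} = 3"
      by (simp add: card_image card_Diff_subset CARD_gf4)
  qed auto
  then show "I2 (PSL :: (gf4^3^3) set monoid) = 315"
    using I2_FactGroup_mult[OF fin] Y by (simp add: card_center_SL3_gf4 PSL_def)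
qed

section \<open>Symplectic transvections\<close>

abbreviation sform :: "'k::field^4 \<Rightarrow> 'k^4 \<Rightarrow> 'k" where "sform \<equiv> symplectic_form4"

lemma sform_add: "sform (x + y) z = sform x z + sform y z" "sform z (x + y) = sform z x + sform z y"
  and sform_diff: "sform (x - y) z = sform x z - sform y z" "sform z (x - y) = sform z x - sform z y"
  and sform_minus: "sform (- x) z = - sform x z" "sform z (- x) = - sform z x"
  and sform_scale: "sform (c *s x) z = c * sform x z" "sform z (c *s x) = c * sform z x"
  and sform_self [simp]: "sform x x = 0"
  and sform_zero [simp]: "sform 0 z = 0" "sform z 0 = 0"
  by (simp_all add: symplectic_form4_def algebra_simps)

lemmas sform_simps = sform_add sform_diff sform_minus sform_scale

lemma sform_skew: "sform y x = - sform x y"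
  by (simp add: symplectic_form4_def algebra_simps)

lemma sform_nondegenerate:
  assumes "u \<noteq> 0"
  obtains w where "sform u w = 1"
proof -
  obtain z where z: "sform u z \<noteq> 0"
    using nondegenerate_symplectic_form4 assms unfolding nondegenerate_form_def by blast
  then have "sform u ((1 / sform u z) *s z) = 1" by (simp add: sform_scale)
  then show ?thesis using that by blast
qed

lemma sform_eqI: "(\<And>z. sform x z = sform y z) \<Longrightarrow> x = y"
  using sform_nondegenerate[of "x - y"] by (auto simp: sform_diff)

text \<open>
  By nondegeneracy independent vectors give independent functionals.
\<close>

lemma sform_two_functionals:
  assumes u: "u \<noteq> 0" and v: "\<And>c. v \<noteq> c *s u"
  obtains w where "sform u w = a" "sform v w = b"
proof -
  obtain y where y: "sform u y = 1" using u sform_nondegenerate by blast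
  have "\<exists>x. sform u x = 0 \<and> sform v x \<noteq> 0"
  proof (rule ccontr)
    assume no: "\<not> ?thesis"
    have "sform v z = sform (sform v y *s u) z" for z
    proof -
      have "sform u (z - sform u z *s y) = 0" by (simp add: sform_simps y)
      then have "sform v (z - sform u z *s y) = 0" using no by blast
      then show ?thesis by (simp add: sform_simps mult.commute)
    qed
    then show False using sform_eqI v by blast
  qed
  then obtain x where x: "sform u x = 0" "sform v x \<noteq> 0" by blast
  show ?thesis
    by (rule that[of "a *s y + ((b - a * sform v y) / sform v x) *s x"])
      (use x y in \<open>auto simp: sform_simps\<close>)
qed

lemma sform_common_nonorthogonal:
  assumes "u \<noteq> 0" "v \<noteq> 0"
  obtains w where "sform u w \<noteq> 0" "sform v w \<noteq> 0"
proof -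
  obtain a b where ab: "sform u a = 1" "sform v b = 1"
    using sform_nondegenerate assms by metis
  then have "(sform u a \<noteq> 0 \<and> sform v a \<noteq> 0) \<or> (sform u b \<noteq> 0 \<and> sform v b \<noteq> 0)
      \<or> (sform u (a + b) \<noteq> 0 \<and> sform v (a + b) \<noteq> 0)"
    by (auto simp: sform_add)
  then show ?thesis using that by blast
qed

lemma matrix_of_linear:
  fixes f :: "'k::field^'n \<Rightarrow> 'k^'m"
  assumes "\<And>x y. f (x + y) = f x + f y" "\<And>c x. f (c *s x) = c *s f x"
  shows "matrix f *v x = f x"
proof -
  have "Vector_Spaces.linear (*s) (*s) f"
    using assms by (intro Vector_Spaces.linear_iff[THEN iffD2] conjI vec.vector_space_axioms) auto
  then show ?thesis by (rule matrix_works)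
qed

definition transvection :: "'k::field \<Rightarrow> 'k^4 \<Rightarrow> 'k^4^4" where
  "transvection c u = matrix (\<lambda>x. x + (c * sform x u) *s u)"

lemma transvection_vec: "transvection c u *v x = x + (c * sform x u) *s u"
  unfolding transvection_def
  by (rule matrix_of_linear) (simp_all add: sform_simps vec_eq_iff algebra_simps)

lemma carrier_Sp: "A \<in> carrier (Sp sform) \<longleftrightarrow> (\<forall>x y. sform (A *v x) (A *v y) = sform x y)"
  and mult_Sp [simp]: "mult (Sp sform) = (**)"
  and one_Sp [simp]: "one (Sp sform) = mat 1"
  by (simp_all add: Sp_def)

lemma SpD: "A \<in> carrier (Sp sform) \<Longrightarrow> sform (A *v x) (A *v y) = sform x y"
  by (simp add: carrier_Sp)

lemma group_Sp: "group (Sp (sform :: 'k::field^4 \<Rightarrow> _))"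
proof (rule groupI)
  fix A :: "'k^4^4" assume A: "A \<in> carrier (Sp sform)"
  have "x = 0" if "A *v x = 0" for x
    by (rule sform_eqI) (metis A SpD sform_zero(1) that)
  then have "\<exists>L. L ** A = mat 1" by (simp add: matrix_left_invertible_ker)
  then obtain L where L: "L ** A = mat 1" ..
  then have "A ** L = mat 1" by (simp add: matrix_left_right_inverse)
  then have "A *v (L *v x) = x" for x by (simp add: matrix_vector_mul_assoc)
  then have "L \<in> carrier (Sp sform)"
    using SpD[OF A, of "L *v _" "L *v _"] by (simp add: carrier_Sp)
  then show "\<exists>L\<in>carrier (Sp sform). L \<otimes>\<^bsub>Sp sform\<^esub> A = \<one>\<^bsub>Sp sform\<^esub>" using L by auto
qed (auto simp: carrier_Sp matrix_mul_assoc simp flip: matrix_vector_mul_assoc)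

lemma Sp_inverse:
  assumes "P \<in> carrier (Sp (sform :: 'k::field^4 \<Rightarrow> _))"
  obtains Q where "Q \<in> carrier (Sp sform)" "P ** Q = mat 1" "Q ** P = mat 1"
  using group.inv_closed[OF group_Sp assms] group.r_inv[OF group_Sp assms]
    group.l_inv[OF group_Sp assms] that by simp

lemma transvection_Sp: "transvection c u \<in> carrier (Sp sform)"
proof -
  have "sform (x + (c * sform x u) *s u) (y + (c * sform y u) *s u) = sform x y" for x y
    using sform_skew[of u y] by (simp add: sform_simps algebra_simps)
  then show ?thesis by (simp add: carrier_Sp transvection_vec)
qed

lemma transvection_add: "transvection c u ** transvection d u = transvection (c + d) u"
  by (simp add: matrix_eq transvection_vec sform_simps flip: matrix_vector_mul_assoc)
    (simp add: vec_eq_iff algebra_simps)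

lemma transvection_0 [simp]: "transvection 0 u = mat 1" "transvection c 0 = mat 1"
  by (simp_all add: matrix_eq transvection_vec)

lemma transvection_conj:
  assumes "A \<in> carrier (Sp sform)"
  shows "transvection c (A *v u) ** A = A ** transvection c u"
  by (simp add: matrix_eq transvection_vec SpD[OF assms] matrix_vector_right_distrib
      vector_scalar_commute flip: matrix_vector_mul_assoc)

lemma inv_transvection: "inv\<^bsub>Sp sform\<^esub> (transvection c u) = transvection (- c) u"
  by (rule group.inv_equality[OF group_Sp]) (simp_all add: transvection_Sp transvection_add)

lemma transvection_maps:
  assumes "sform u v \<noteq> 0"
  shows "transvection (1 / sform u v) (u - v) *v u = v"
  using assms by (simp add: transvection_vec sform_simps)

lemma transvection_fixes: "sform x u = 0 \<Longrightarrow> transvection c u *v x = x"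
  by (simp add: transvection_vec)

text \<open>
  The two transitivity statements below are needed both for the whole space and for the
  orthogonal complement \<open>W\<close> of a hyperbolic plane, with \<open>H\<close> consisting of matrices that fix
  the plane pointwise.
\<close>

locale transvection_monoid =
  fixes W :: "('k::field^4) set" and H :: "('k^4^4) set"
  assumes W_add: "\<And>x y. x \<in> W \<Longrightarrow> y \<in> W \<Longrightarrow> x + y \<in> W"
    and W_scale: "\<And>c x. x \<in> W \<Longrightarrow> c *s x \<in> W"
    and W_nondegenerate: "\<And>u. u \<in> W \<Longrightarrow> u \<noteq> 0 \<Longrightarrow> \<exists>w\<in>W. sform u w \<noteq> 0"
    and H_Sp: "H \<subseteq> carrier (Sp sform)"
    and H_W: "\<And>t x. t \<in> H \<Longrightarrow> x \<in> W \<Longrightarrow> t *v x \<in> W"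
    and H_one: "mat 1 \<in> H"
    and H_mult: "\<And>s t. s \<in> H \<Longrightarrow> t \<in> H \<Longrightarrow> s ** t \<in> H"
    and H_transvection: "\<And>c u. u \<in> W \<Longrightarrow> transvection c u \<in> H"
begin

lemma W_diff: "x \<in> W \<Longrightarrow> y \<in> W \<Longrightarrow> x - y \<in> W"
  using W_add[of x "(- 1) *s y"] W_scale[of y "- 1"] by simp

text \<open>
  A vector that is not orthogonal to \<open>u\<close>, one that is not orthogonal to \<open>v\<close>, or their sum.
\<close>

lemma common_nonorthogonal:
  assumes "u \<in> W" "v \<in> W" "u \<noteq> 0" "v \<noteq> 0"
  obtains w where "w \<in> W" "sform u w \<noteq> 0" "sform v w \<noteq> 0"
proof -
  obtain a b where ab: "a \<in> W" "b \<in> W" "sform u a \<noteq> 0" "sform v b \<noteq> 0"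
    using W_nondegenerate assms by meson
  then have "(sform u a \<noteq> 0 \<and> sform v a \<noteq> 0) \<or> (sform u b \<noteq> 0 \<and> sform v b \<noteq> 0)
      \<or> (sform u (a + b) \<noteq> 0 \<and> sform v (a + b) \<noteq> 0)"
    by (auto simp: sform_add)
  then show ?thesis using that ab W_add by blast
qed

text \<open>
  A vector \<open>u\<close> is moved to a \<open>v\<close> that is not orthogonal to it by a transvection along \<open>u - v\<close>;
  in general one passes through a third vector.
\<close>

lemma transitive_on_vectors:
  assumes "u \<in> W" "v \<in> W" "u \<noteq> 0" "v \<noteq> 0"
  obtains t where "t \<in> H" "t *v u = v"
proof -
  have direct: "\<exists>t\<in>H. t *v x = y" if "x \<in> W" "y \<in> W" "sform x y \<noteq> 0" for x y
    using transvection_maps[OF that(3)] H_transvection[OF W_diff[OF that(1,2)]] by blast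
  obtain w where w: "w \<in> W" "sform u w \<noteq> 0" "sform v w \<noteq> 0"
    using common_nonorthogonal[OF assms] by blast
  then have "sform w v \<noteq> 0" using sform_skew[of v w] by simp
  then obtain s t where "s \<in> H" "t \<in> H" "s *v u = w" "t *v w = v"
    using direct w assms by meson
  then show ?thesis using that[of "t ** s"] H_mult by (simp flip: matrix_vector_mul_assoc)
qed

text \<open>
  Once the first vectors agree, the second vectors \<open>v1\<close> and \<open>v'\<close> have a difference orthogonal
  to \<open>u'\<close>, so the transvection along it fixes \<open>u'\<close>. If \<open>v1\<close> and \<open>v'\<close> are orthogonal, one
  passes through \<open>u' + v1\<close>.
\<close>

lemma transitive_on_hyperbolic_pairs:
  assumes W: "u \<in> W" "v \<in> W" "u' \<in> W" "v' \<in> W" and hyp: "sform u v = 1" "sform u' v' = 1"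
  obtains t where "t \<in> H" "t *v u = u'" "t *v v = v'"
proof -
  have "u \<noteq> 0" "u' \<noteq> 0" using hyp by auto
  then obtain s where s: "s \<in> H" "s *v u = u'" using transitive_on_vectors[of u u'] W by blast
  define v1 where "v1 = s *v v"
  have v1: "v1 \<in> W" "sform u' v1 = 1"
    using H_W s W H_Sp SpD[of s u v] hyp by (auto simp: v1_def)
  have direct: "\<exists>t\<in>H. t *v u' = u' \<and> t *v x = y"
    if "x \<in> W" "y \<in> W" "sform x y \<noteq> 0" "sform u' x = 1" "sform u' y = 1" for x y
    using transvection_maps[OF that(3)] transvection_fixes[of u' "x - y"]
      H_transvection[OF W_diff[OF that(1,2)]] that(4,5) by (metis cancel_comm_monoid_add_class.diff_cancel sform_diff(2))
  have "\<exists>t\<in>H. t *v u' = u' \<and> t *v v1 = v'"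
  proof (cases "sform v1 v' = 0")
    case False
    then show ?thesis using direct v1 W hyp by blast
  next
    case True
    let ?w = "u' + v1"
    have "?w \<in> W" "sform u' ?w = 1" "sform v1 ?w \<noteq> 0" "sform ?w v' \<noteq> 0"
      using v1 W hyp True W_add sform_skew[of v1 u'] by (auto simp: sform_add)
    then obtain t t' where "t \<in> H" "t *v u' = u'" "t *v v1 = ?w" "t' \<in> H" "t' *v u' = u'" "t' *v ?w = v'"
      using direct[of v1 ?w] direct[of ?w v'] v1 W hyp by auto
    then show ?thesis
      using H_mult by (intro bexI[of _ "t' ** t"]) (simp_all flip: matrix_vector_mul_assoc)
  qed
  then obtain t where "t \<in> H" "t *v u' = u'" "t *v v1 = v'" by blast
  then show ?thesis
    using that[of "t ** s"] s H_mult by (simp add: v1_def flip: matrix_vector_mul_assoc)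
qed

end

lemma Sp_mult_closed: "s \<in> carrier (Sp sform) \<Longrightarrow> t \<in> carrier (Sp sform) \<Longrightarrow> s ** t \<in> carrier (Sp sform)"
  by (simp add: carrier_Sp flip: matrix_vector_mul_assoc)

lemma Sp_transitive_on_hyperbolic_pairs:
  fixes u v u' v' :: "'k::field^4"
  assumes "sform u v = 1" "sform u' v' = 1"
  obtains t where "t \<in> carrier (Sp sform)" "t *v u = u'" "t *v v = v'"
proof -
  interpret transvection_monoid "UNIV :: ('k^4) set" "carrier (Sp sform)"
  proof
    show "\<exists>w\<in>UNIV. sform u w \<noteq> 0" if "u \<noteq> 0" for u :: "'k^4"
      using sform_nondegenerate[OF that] zero_neq_one by (metis UNIV_I)
    show "mat 1 \<in> carrier (Sp sform)" by (simp add: carrier_Sp)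
  qed (auto simp: transvection_Sp Sp_mult_closed)
  show ?thesis
    by (rule transitive_on_hyperbolic_pairs[OF UNIV_I UNIV_I UNIV_I UNIV_I assms]) (rule that)
qed

lemma matrix_eq_on_axes:
  fixes A :: "'k::field^4^4"
  assumes "A *v axis 1 1 = B *v axis 1 1" "A *v axis 2 1 = B *v axis 2 1"
    "A *v axis 3 1 = B *v axis 3 1" "A *v axis 4 1 = B *v axis 4 1"
  shows "A = B"
proof -
  have "A $ i $ j = B $ i $ j" for i j
    using exhaust_4[of j] assms by (metis matrix_axis_nth)
  then show ?thesis by (simp add: vec_eq_iff)
qed

lemma sform_axis:
  "sform x (axis 1 1) = - x $ 3" "sform x (axis 2 1) = - x $ 4" "sform x (axis 3 1) = x $ 1" "sform x (axis 4 1) = x $ 2"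
  "sform (axis 1 1) x = x $ 3" "sform (axis 2 1) x = x $ 4" "sform (axis 3 1) x = - x $ 1" "sform (axis 4 1) x = - x $ 2"
  by (simp_all add: symplectic_form4_def axis_def)

text \<open>
  Transvections correct the images of \<open>e1\<close> and \<open>e3\<close>. The rest acts on the orthogonal
  complement of these vectors, where the same argument applies with transvections along
  vectors of the complement.
\<close>

lemma Sp_generated_by_transvections:
  fixes A :: "'k::field^4^4"
  assumes one: "mat 1 \<in> H" and mult: "\<And>s t. s \<in> H \<Longrightarrow> t \<in> H \<Longrightarrow> s ** t \<in> H"
    and tr: "\<And>c u. u \<noteq> 0 \<Longrightarrow> transvection c u \<in> H"
    and A: "A \<in> carrier (Sp sform)"
  shows "A \<in> H"
proof -
  have tr': "transvection c u \<in> H" for c u using tr[of u c] one by (cases "u = 0") auto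
  have one_mem: "mat 1 \<in> carrier (Sp (sform :: 'k^4 \<Rightarrow> _))" by (simp add: carrier_Sp)
  interpret V: transvection_monoid UNIV "H \<inter> carrier (Sp sform)"
  proof
    show "\<exists>w\<in>UNIV. sform u w \<noteq> 0" if "u \<noteq> 0" for u :: "'k^4"
      using sform_nondegenerate[OF that] zero_neq_one by (metis UNIV_I)
    show "s ** t \<in> H \<inter> carrier (Sp sform)"
      if "s \<in> H \<inter> carrier (Sp sform)" "t \<in> H \<inter> carrier (Sp sform)" for s t
      using that mult Sp_mult_closed by blast
    show "transvection c u \<in> H \<inter> carrier (Sp sform)" for c u using tr' transvection_Sp by blast
    show "mat 1 \<in> H \<inter> carrier (Sp sform)" using one one_mem by blast
  qed simp_all
  let ?e1 = "axis 1 1 :: 'k^4" and ?e2 = "axis 2 1 :: 'k^4"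
    and ?f1 = "axis 3 1 :: 'k^4" and ?f2 = "axis 4 1 :: 'k^4"
  have hyp: "sform ?e1 ?f1 = 1" "sform ?e2 ?f2 = 1" by (simp_all add: symplectic_form4_def axis_def)
  have "sform (A *v ?e1) (A *v ?f1) = 1" by (simp add: SpD[OF A] hyp)
  from V.transitive_on_hyperbolic_pairs[OF UNIV_I UNIV_I UNIV_I UNIV_I hyp(1) this]
  obtain t where t: "t \<in> H" "t \<in> carrier (Sp sform)" "t *v ?e1 = A *v ?e1" "t *v ?f1 = A *v ?f1"
    by blast
  obtain t' where t': "t' \<in> carrier (Sp sform)" "t ** t' = mat 1" "t' ** t = mat 1"
    using Sp_inverse[OF t(2)] by blast
  define g where "g = t' ** A"
  have g: "g \<in> carrier (Sp sform)" unfolding g_def by (rule Sp_mult_closed[OF t'(1) A])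
  have "g *v ?e1 = t' *v (t *v ?e1)" "g *v ?f1 = t' *v (t *v ?f1)"
    by (simp_all add: g_def t(3,4) flip: matrix_vector_mul_assoc)
  then have ge: "g *v ?e1 = ?e1" "g *v ?f1 = ?f1"
    using t'(3) by (simp_all add: matrix_vector_mul_assoc)
  define W where "W = {x :: 'k^4. x $ 1 = 0 \<and> x $ 3 = 0}"
  define K where "K = {s \<in> H \<inter> carrier (Sp sform). s *v ?e1 = ?e1 \<and> s *v ?f1 = ?f1}"
  have W_inv: "s *v x \<in> W" if "s \<in> carrier (Sp sform)" "s *v ?e1 = ?e1" "s *v ?f1 = ?f1" "x \<in> W" for s x
    using SpD[OF that(1), of x ?e1] SpD[OF that(1), of x ?f1] that
    by (simp add: W_def sform_axis)
  interpret W: transvection_monoid W K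
  proof
    show "\<exists>w\<in>W. sform u w \<noteq> 0" if "u \<in> W" "u \<noteq> 0" for u
    proof -
      have "u $ 2 \<noteq> 0 \<or> u $ 4 \<noteq> 0" using that by (auto simp: W_def vec_eq_iff forall_4)
      moreover have "?e2 \<in> W" "?f2 \<in> W" by (auto simp: W_def axis_def)
      ultimately show ?thesis using sform_axis by (metis neg_equal_0_iff_equal)
    qed
    show "transvection c u \<in> K" if "u \<in> W" for c u
      using that by (simp add: K_def tr' transvection_Sp transvection_fixes W_def sform_axis)
    show "s ** t \<in> K" if "s \<in> K" "t \<in> K" for s t
      using that mult Sp_mult_closed by (auto simp: K_def simp flip: matrix_vector_mul_assoc)
    show "t *v x \<in> W" if "t \<in> K" "x \<in> W" for t x using that W_inv by (auto simp: K_def)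
    show "mat 1 \<in> K" using one one_mem by (simp add: K_def)
  qed (auto simp: W_def K_def)
  have "?e2 \<in> W" "?f2 \<in> W" by (auto simp: W_def axis_def)
  moreover from this have "g *v ?e2 \<in> W" "g *v ?f2 \<in> W" using W_inv[OF g ge] by auto
  moreover have "sform (g *v ?e2) (g *v ?f2) = 1" by (simp add: SpD[OF g] hyp)
  ultimately obtain s where s: "s \<in> K" "s *v ?e2 = g *v ?e2" "s *v ?f2 = g *v ?f2"
    using W.transitive_on_hyperbolic_pairs[OF _ _ _ _ hyp(2)] by blast
  have "s = g" by (rule matrix_eq_on_axes) (use s ge in \<open>auto simp: K_def\<close>)
  moreover have "A = t ** g" by (simp add: g_def matrix_mul_assoc t')
  ultimately show ?thesis using mult t(1) s(1) by (simp add: K_def)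
qed

section \<open>Normal subgroups of the symplectic group\<close>

text \<open>
  Nonzero vectors \<open>u\<close> with \<open>A u = - u\<close> and \<open>v\<close> with \<open>A v = v\<close> cannot both exist: neither sign
  fits \<open>u + v\<close>.
\<close>

lemma pm_identity_if_pointwise_pm:
  fixes A :: "'k::field^4^4"
  assumes two: "(2 :: 'k) \<noteq> 0" and pm: "\<And>u. A *v u = u \<or> A *v u = - u"
  shows "A = mat 1 \<or> A = mat (- 1)"
proof (rule ccontr)
  assume no: "\<not> ?thesis"
  have m1: "mat (- 1) *v x = - x" for x :: "'k^4" by (simp add: mat_vec vec_eq_iff)
  obtain u v where u: "A *v u \<noteq> u" and v: "A *v v \<noteq> - v"
    using no by (auto simp: matrix_eq m1)
  have u': "A *v u = - u" and v': "A *v v = v" using pm u v by blast+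
  have dbl: "x = 0" if "x = - x" for x :: "'k^4"
  proof -
    have "2 * x $ i = 0" for i
      using arg_cong[OF that, of "\<lambda>x. x $ i"] by (metis add.right_inverse mult_2 vector_uminus_component)
    then show ?thesis using two by (simp add: vec_eq_iff)
  qed
  have "A *v (u + v) = - u + v" by (simp add: matrix_vector_right_distrib u' v')
  then have "- u + v = u + v \<or> - u + v = - (u + v)" using pm[of "u + v"] by simp
  then have "u = - u \<or> v = - v" by (auto simp: algebra_simps)
  then show False using dbl[of u] dbl[of v] u v by auto
qed

lemma pm_identity_in_center:
  "mat 1 \<in> group_center (Sp sform)" "mat (- 1) \<in> group_center (Sp (sform :: 'k::field^4 \<Rightarrow> _))"
proof -
  have "mat (- 1) *v x = - x" for x :: "'k^4" by (simp add: mat_vec vec_eq_iff)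
  then show "mat (- 1) \<in> group_center (Sp (sform :: 'k::field^4 \<Rightarrow> _))"
    by (simp add: group_center_def carrier_Sp mat_mult_commute sform_minus)
qed (simp add: group_center_def carrier_Sp)

text \<open>
  An element commuting with the transvection along \<open>u\<close> preserves its direction \<open>u\<close>, say with
  factor \<open>s\<close>, and invariance of the form gives \<open>s * s = 1\<close>.
\<close>

lemma group_center_Sp:
  assumes two: "(2 :: 'k::field) \<noteq> 0"
  shows "group_center (Sp (sform :: 'k^4 \<Rightarrow> _)) = {mat 1, mat (- 1)}"
proof
  show "{mat 1, mat (- 1)} \<subseteq> group_center (Sp (sform :: 'k^4 \<Rightarrow> _))"
    using pm_identity_in_center by simp
  show "group_center (Sp (sform :: 'k^4 \<Rightarrow> _)) \<subseteq> {mat 1, mat (- 1)}"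
  proof
    fix A :: "'k^4^4" assume A: "A \<in> group_center (Sp sform)"
    then have AS: "A \<in> carrier (Sp sform)" by (simp add: group_center_def)
    have "A *v u = u \<or> A *v u = - u" for u
    proof (cases "u = 0")
      case False
      have "A ** transvection 1 u = transvection 1 u ** A"
        proof -
        have "\<forall>g\<in>carrier (Sp sform). A ** g = g ** A" using A by (simp add: group_center_def)
        then show ?thesis using transvection_Sp by blast
      qed
      then have eq: "A *v (transvection 1 u *v x) = transvection 1 u *v (A *v x)" for x
        by (simp add: matrix_vector_mul_assoc)
      have eq: "sform x u *s (A *v u) = sform (A *v x) u *s u" for x
        using eq[of x] by (simp add: transvection_vec matrix_vector_right_distrib vector_scalar_commute)
      obtain x where "sform u x = 1" using sform_nondegenerate[OF False] by blast
      then have x: "sform (- x) u = 1" using sform_skew[of x u] by (simp add: sform_minus)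
      define s where "s = sform (A *v (- x)) u"
      have Au: "A *v u = s *s u" using eq[of "- x"] x by (simp add: s_def)
      have "s * s = sform (A *v (- x)) (A *v u)" unfolding Au by (simp add: s_def sform_scale)
      also have "\<dots> = 1" by (simp only: SpD[OF AS] x)
      finally have "s = 1 \<or> s = - 1" by (simp add: square_eq_1_iff)
      then show ?thesis using Au by (auto simp: vec_eq_iff)
    qed simp
    then show "A \<in> {mat 1, mat (- 1)}" using pm_identity_if_pointwise_pm[OF two, of A] by auto
  qed
qed

text \<open>
  With respect to the isotropic planes of \<open>e1\<close>, \<open>e2\<close> and of \<open>e3\<close>, \<open>e4\<close>, the block matrices
  \<open>D = diag(P, P\<^sup>-\<^sup>T)\<close> and \<open>U = (1, S; 0, 1)\<close>, with \<open>S\<close> symmetric, have as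
  commutator the block matrix with upper right block \<open>P S P\<^sup>T - S\<close>. For
  \<open>P = (1, 1; 0, 1)\<close> and \<open>S = (0, b; b, 0)\<close> that block is \<open>(2 b, 0; 0, 0)\<close>; hence the choice
  of \<open>b\<close>.
\<close>

lemma transvection_is_commutator:
  fixes c :: "'k::field"
  assumes two: "(2 :: 'k) \<noteq> 0"
  obtains D U where "D \<in> carrier (Sp sform)" "U \<in> carrier (Sp sform)"
    "transvection c (axis 1 1) ** (U ** D) = D ** U"
proof -
  define b where "b = - c / 2"
  define D where "D = matrix (\<lambda>x :: 'k^4. (vector [x$1 + x$2, x$2, x$3, x$4 - x$3] :: 'k^4))"
  define U where "U = matrix (\<lambda>x :: 'k^4. (vector [x$1 + b * x$4, x$2 + b * x$3, x$3, x$4] :: 'k^4))"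
  have vec4: "(vector [p, q, r, s] :: 'k^4) $ 1 = p" "(vector [p, q, r, s] :: 'k^4) $ 2 = q"
    "(vector [p, q, r, s] :: 'k^4) $ 3 = r" "(vector [p, q, r, s] :: 'k^4) $ 4 = s" for p q r s :: 'k
    by (simp_all add: vector_def)
  have D: "D *v x = vector [x$1 + x$2, x$2, x$3, x$4 - x$3]" for x
    unfolding D_def by (rule matrix_of_linear) (simp_all add: vec_eq_iff forall_4 vec4 algebra_simps)
  have U: "U *v x = vector [x$1 + b * x$4, x$2 + b * x$3, x$3, x$4]" for x
    unfolding U_def by (rule matrix_of_linear) (simp_all add: vec_eq_iff forall_4 vec4 algebra_simps)
  have "D \<in> carrier (Sp sform)" "U \<in> carrier (Sp sform)"
    by (simp_all add: carrier_Sp D U symplectic_form4_def vec4 algebra_simps)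
  moreover have "transvection c (axis 1 1) ** (U ** D) = D ** U"
  proof -
    have "c = - b - b" using two by (simp add: b_def field_simps)
    then have "c * t = - (b * t) - b * t" for t by (simp add: algebra_simps)
    then show ?thesis
      by (simp add: matrix_eq transvection_vec D U sform_axis flip: matrix_vector_mul_assoc)
        (simp add: vec_eq_iff forall_4 vec4 axis_def algebra_simps)
  qed
  ultimately show ?thesis using that by blast
qed

text \<open>
  Write \<open>t c u\<close> for the transvection. An element \<open>A\<close> of \<open>N\<close> conjugates \<open>t c u\<close> to \<open>t c (A u)\<close>,
  so these are congruent modulo \<open>N\<close>. If \<open>u\<close> and \<open>A u\<close> are not orthogonal, say with \<open>b\<close> as
  value of the form, transitivity on hyperbolic pairs carries the congruence to all pairs of
  vectors with the value \<open>b\<close>, and any two vectors are connected through such pairs.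
\<close>

theorem Sp_normal_subgroup:
  assumes two: "(2 :: 'k::field) \<noteq> 0"
    and N: "N \<lhd> Sp (sform :: 'k^4 \<Rightarrow> _)" and nc: "\<not> N \<subseteq> group_center (Sp sform)"
  shows "N = carrier (Sp sform)"
proof -
  let ?G = "Sp (sform :: 'k^4 \<Rightarrow> _)"
  let ?t = "transvection :: 'k \<Rightarrow> 'k^4 \<Rightarrow> 'k^4^4"
  interpret normal N ?G by (rule N)
  have comm: "C \<in> N" if "A \<in> N" "Y \<in> carrier ?G" "C \<in> carrier ?G" "C ** (Y ** A) = A ** Y" for A Y C
    using commutator_mem[of A Y C] that by simp
  have tS: "?t c u ** ?t d v \<in> carrier ?G" for c d u v by (intro Sp_mult_closed transvection_Sp)
  have cancel: "?t (- c) u ** (?t c u ** A) = A" for c u A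
    by (simp add: matrix_mul_assoc transvection_add)
  \<comment> \<open>commutators of an element of \<open>N\<close> with a transvection\<close>
  have tN: "?t c (A *v u) ** ?t (- c) u \<in> N" if A: "A \<in> N" for A c u
  proof (rule comm[OF A transvection_Sp[of c u] tS])
    have "?t c (A *v u) ** ?t (- c) u ** (?t c u ** A) = ?t c (A *v u) ** A"
      by (simp only: matrix_mul_assoc[symmetric] cancel)
    then show "?t c (A *v u) ** ?t (- c) u ** (?t c u ** A) = A ** ?t c u"
      using transvection_conj[of A c u] mem_carrier[OF A] by simp
  qed
  \<comment> \<open>an element of \<open>N\<close> moving some vector to a vector that is not orthogonal to it\<close>
  have "\<exists>g\<in>N. \<exists>x. sform x (g *v x) \<noteq> 0"
  proof -
    obtain A where A: "A \<in> N" "A \<notin> group_center ?G" using nc by blast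
    then obtain u where u: "A *v u \<noteq> u" "A *v u \<noteq> - u"
      using pm_identity_if_pointwise_pm[OF two, of A] group_center_Sp[OF two] by blast
    let ?v = "A *v u"
    show ?thesis
    proof (cases "sform u ?v = 0")
      case True
      \<comment> \<open>the commutator of \<open>A\<close> with the transvection along \<open>u\<close>, a product of two commuting transvections, will do\<close>
      have "u - ?v \<noteq> 0" "u + ?v \<noteq> 0" using u by (auto simp: add_eq_0_iff)
      then obtain x where x: "sform (u - ?v) x \<noteq> 0" "sform (u + ?v) x \<noteq> 0"
        using sform_common_nonorthogonal by blast
      have "sform x ((?t 1 ?v ** ?t (- 1) u) *v x) = - (sform (u - ?v) x * sform (u + ?v) x)"
        using True sform_skew[of x u] sform_skew[of x ?v]
        by (simp add: transvection_vec sform_simps algebra_simps flip: matrix_vector_mul_assoc)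
      then show ?thesis using tN[OF A(1), of 1 u] x by (metis mult_eq_0_iff neg_equal_0_iff_equal)
    qed (use A in blast)
  qed
  then obtain g x where g: "g \<in> N" "sform x (g *v x) \<noteq> 0" by blast
  define b where "b = sform x (g *v x)"
  have b: "b \<noteq> 0" using g by (simp add: b_def)
  have gS: "g \<in> carrier ?G" by (rule mem_carrier[OF g(1)])
  have coset: "r_coset ?G N (?t c u) = r_coset ?G N (?t c v) \<longleftrightarrow> ?t c u ** ?t (- c) v \<in> N" for c u v
    using coset_eq_iff[OF transvection_Sp transvection_Sp, of c u c v] by (simp add: inv_transvection)
  \<comment> \<open>transport from \<open>(x, g x)\<close> to \<open>(p, q)\<close>; dividing the second vectors by \<open>b\<close> makes the pairs hyperbolic\<close>
  have step: "r_coset ?G N (?t c p) = r_coset ?G N (?t c q)" if pq: "sform p q = b" for c p q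
  proof -
    have "sform x ((1 / b) *s (g *v x)) = 1" "sform p ((1 / b) *s q) = 1"
      using b pq by (simp_all add: b_def sform_scale)
    then obtain h where h: "h \<in> carrier ?G" "h *v x = p" "h *v ((1 / b) *s (g *v x)) = (1 / b) *s q"
      by (rule Sp_transitive_on_hyperbolic_pairs)
    then have hq: "h *v (g *v x) = q" using b by (simp add: vector_scalar_commute vec_eq_iff)
    have conj: "h ** ?t c u = ?t c (h *v u) ** h" for c u
      by (rule transvection_conj[OF h(1), symmetric])
    have "h ** (?t c (g *v x) ** ?t (- c) x) = (h ** ?t c (g *v x)) ** ?t (- c) x"
      by (simp only: matrix_mul_assoc)
    also have "\<dots> = ?t c q ** (h ** ?t (- c) x)"
      unfolding conj[of c "g *v x"] hq by (simp only: matrix_mul_assoc)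
    also have "\<dots> = (?t c q ** ?t (- c) p) ** h"
      unfolding conj[of "- c" x] h(2) by (simp only: matrix_mul_assoc)
    finally have "?t c q ** ?t (- c) p \<in> N"
      using conj_mem[of h "?t c (g *v x) ** ?t (- c) x" "?t c q ** ?t (- c) p"] h(1) tN[OF g(1)] tS by simp
    then show ?thesis using coset by blast
  qed
  have indep: "r_coset ?G N (?t c u) = r_coset ?G N (?t c v)"
    if uv: "u \<noteq> 0" "\<And>d. v \<noteq> d *s u" for c u v
  proof -
    obtain w where "sform u w = b" "sform v w = b" using sform_two_functionals[OF uv] by blast
    then show ?thesis using step by metis
  qed
  have all: "r_coset ?G N (?t c u) = r_coset ?G N (?t c v)" if uv: "u \<noteq> 0" "v \<noteq> 0" for c u v
  proof (cases "\<exists>d. v = d *s u")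
    case True
    then obtain d where d: "v = d *s u" "d \<noteq> 0" using uv by auto
    obtain z where z: "sform u z = 1" using sform_nondegenerate uv by blast
    have "z \<noteq> r *s u" for r using z by (auto simp: sform_scale)
    moreover have "z \<noteq> r *s v" for r using z by (auto simp: sform_scale d)
    ultimately show ?thesis using indep uv by metis
  qed (use indep uv in blast)
  \<comment> \<open>hence the quotient by \<open>N\<close> is covered by the abelian group of transvections along \<open>e1\<close>\<close>
  define e where "e = (axis 1 1 :: 'k^4)"
  have "e \<noteq> 0" by (simp add: e_def)
  let ?A = "range (\<lambda>c. ?t c e)"
  have subA: "subgroup ?A ?G"
  proof (rule subgroupI)
    show "inv\<^bsub>?G\<^esub> a \<in> ?A" if "a \<in> ?A" for a using that by (auto simp: inv_transvection)
    show "a \<otimes>\<^bsub>?G\<^esub> b \<in> ?A" if "a \<in> ?A" "b \<in> ?A" for a b using that by (auto simp: transvection_add)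
  qed (auto simp: transvection_Sp)
  interpret second_isomorphism_grp N ?G ?A 
    by (intro second_isomorphism_grp.intro second_isomorphism_grp_axioms.intro normal_axioms subA)
  have sub: "subgroup (set_mult ?G N ?A) ?G" by (rule normal_set_mult_subgroup)
  have tNA: "?t c u \<in> set_mult ?G N ?A" if "u \<noteq> 0" for c u
  proof -
    have "?t c u ** ?t (- c) e \<in> N" using all[OF that \<open>e \<noteq> 0\<close>] coset by blast
    moreover have "?t c u = (?t c u ** ?t (- c) e) ** ?t c e"
      by (simp add: transvection_add flip: matrix_mul_assoc)
    ultimately show ?thesis unfolding set_mult_def by fastforce
  qed
  have "A \<in> set_mult ?G N ?A" if "A \<in> carrier ?G" for A
  proof (rule Sp_generated_by_transvections[OF _ _ tNA that])
    show "mat 1 \<in> set_mult ?G N ?A" using subgroup.one_closed[OF sub] by simp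
    show "s ** t \<in> set_mult ?G N ?A" if "s \<in> set_mult ?G N ?A" "t \<in> set_mult ?G N ?A" for s t
      using subgroup.m_closed[OF sub that] by simp
  qed
  then have NA: "set_mult ?G N ?A = carrier ?G" using subgroup.subset[OF sub] by blast
  have te: "?t c e \<in> N" for c
  proof -
    obtain D U where DU: "D \<in> carrier ?G" "U \<in> carrier ?G" "?t c e ** (U ** D) = D ** U"
      unfolding e_def by (rule transvection_is_commutator[OF two])
    have "D \<otimes>\<^bsub>?G\<^esub> U \<otimes>\<^bsub>?G\<^esub> inv\<^bsub>?G\<^esub> (U \<otimes>\<^bsub>?G\<^esub> D) \<in> N"
      by (rule commutator_mem_if_abelian_supplement[OF subgroup.subset[OF subA] _ NA DU(1,2)])
        (auto simp: transvection_add add.commute)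
    moreover have "?t c e \<otimes>\<^bsub>?G\<^esub> (U \<otimes>\<^bsub>?G\<^esub> D) = D \<otimes>\<^bsub>?G\<^esub> U" using DU(3) by simp
    then have "D \<otimes>\<^bsub>?G\<^esub> U \<otimes>\<^bsub>?G\<^esub> inv\<^bsub>?G\<^esub> (U \<otimes>\<^bsub>?G\<^esub> D) = ?t c e"
      using DU(1,2) transvection_Sp inv_solve_right' group.is_monoid by (metis m_closed)
    ultimately show ?thesis by simp
  qed
  have "A \<in> N" if "A \<in> carrier ?G" for A
  proof (rule Sp_generated_by_transvections[OF _ _ _ that])
    show "mat 1 \<in> N" using subgroup.one_closed[OF subgroup_axioms] by simp
    show "s ** t \<in> N" if "s \<in> N" "t \<in> N" for s t
      using subgroup.m_closed[OF subgroup_axioms that] by simp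
    show "?t c u \<in> N" if "u \<noteq> 0" for c u
    proof -
      have "r_coset ?G N (?t c u) = N"
        using all[OF that \<open>e \<noteq> 0\<close>, of c] coset_eq_self_iff[OF transvection_Sp, of c e] te by simp
      then show ?thesis using coset_eq_self_iff[OF transvection_Sp] by blast
    qed
  qed
  then show ?thesis using subset by blast
qed

section \<open>Symplectic matrices preserving a hyperbolic plane\<close>

lemma vector_4 [simp]:
  "(vector [p, q, r, s] :: 'k::zero^4) $ 1 = p" "(vector [p, q, r, s] :: 'k^4) $ 2 = q"
  "(vector [p, q, r, s] :: 'k^4) $ 3 = r" "(vector [p, q, r, s] :: 'k^4) $ 4 = s"
  by (simp_all add: vector_def)

lemma axis_nth: "axis i a $ j = (if j = i then a else 0)"
  by (simp add: axis_def)

text \<open>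
  The direct sum of a matrix \<open>(p, q; r, s)\<close> on the plane of \<open>e1\<close>, \<open>e3\<close> and a matrix
  \<open>(a, b; c, d)\<close> on the plane of \<open>e2\<close>, \<open>e4\<close>, two orthogonal hyperbolic planes.
\<close>

definition plane_sum :: "'k \<Rightarrow> 'k \<Rightarrow> 'k \<Rightarrow> 'k \<Rightarrow> 'k \<Rightarrow> 'k \<Rightarrow> 'k \<Rightarrow> 'k \<Rightarrow> 'k::field^4^4" where
  "plane_sum p q r s a b c d =
    matrix (\<lambda>x. vector [p * x$1 + q * x$3, a * x$2 + b * x$4, r * x$1 + s * x$3, c * x$2 + d * x$4])"

lemma plane_sum_vec:
  "plane_sum p q r s a b c d *v x =
    vector [p * x$1 + q * x$3, a * x$2 + b * x$4, r * x$1 + s * x$3, c * x$2 + d * x$4]"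
  unfolding plane_sum_def
  by (rule matrix_of_linear) (simp_all add: vec_eq_iff forall_4 algebra_simps)

lemma plane_sum_mult:
  "plane_sum p q r s a b c d ** plane_sum p' q' r' s' a' b' c' d' =
    plane_sum (p * p' + q * r') (p * q' + q * s') (r * p' + s * r') (r * q' + s * s')
      (a * a' + b * c') (a * b' + b * d') (c * a' + d * c') (c * b' + d * d')"
  by (simp add: matrix_eq plane_sum_vec flip: matrix_vector_mul_assoc)
    (simp add: vec_eq_iff forall_4 algebra_simps)

lemma mat_eq_plane_sum: "mat t = plane_sum t 0 0 t t 0 0 t"
  by (simp add: matrix_eq plane_sum_vec mat_vec vec_eq_iff forall_4)

lemma plane_sum_eq_iff:
  "plane_sum p q r s a b c d = plane_sum p' q' r' s' a' b' c' d' \<longleftrightarrow>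
    p = p' \<and> q = q' \<and> r = r' \<and> s = s' \<and> a = a' \<and> b = b' \<and> c = c' \<and> d = d'"
proof
  assume eq: "plane_sum p q r s a b c d = plane_sum p' q' r' s' a' b' c' d'"
  show "p = p' \<and> q = q' \<and> r = r' \<and> s = s' \<and> a = a' \<and> b = b' \<and> c = c' \<and> d = d'"
    using arg_cong[OF eq, of "\<lambda>A. A *v axis 1 1"] arg_cong[OF eq, of "\<lambda>A. A *v axis 2 1"]
      arg_cong[OF eq, of "\<lambda>A. A *v axis 3 1"] arg_cong[OF eq, of "\<lambda>A. A *v axis 4 1"]
    by (simp add: plane_sum_vec vec_eq_iff forall_4 axis_nth)
qed simp

lemma plane_sum_Sp:
  assumes "p * s - q * r = 1" "a * d - b * c = 1"
  shows "plane_sum p q r s a b c d \<in> carrier (Sp sform)"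
proof -
  have "sform (plane_sum p q r s a b c d *v x) (plane_sum p q r s a b c d *v y) = 
      (p * s - q * r) * (x$1 * y$3 - x$3 * y$1) + (a * d - b * c) * (x$2 * y$4 - x$4 * y$2)" for x y
    by (simp add: plane_sum_vec symplectic_form4_def algebra_simps)
  then show ?thesis using assms by (simp add: carrier_Sp symplectic_form4_def)
qed

text \<open>
  The image of the orthogonal complement of the plane is orthogonal to the image of the plane,
  which is the plane itself.
\<close>

lemma Sp_preserving_plane:
  assumes A: "A \<in> carrier (Sp (sform :: 'k::field^4 \<Rightarrow> _))"
    and e: "A *v axis 1 1 = vector [p, 0, r, 0]" "A *v axis 3 1 = vector [q, 0, s, 0]"
  obtains a b c d where "A = plane_sum p q r s a b c d" "p * s - q * r = 1" "a * d - b * c = 1"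
proof -
  have 1: "p * s - q * r = 1"
    using SpD[OF A, of "axis 1 1" "axis 3 1"] by (simp add: e symplectic_form4_def axis_nth algebra_simps)
  have perp: "(A *v x) $ 1 = 0 \<and> (A *v x) $ 3 = 0" if "x $ 1 = 0" "x $ 3 = 0" for x
  proof -
    let ?y = "A *v x"
    have y: "?y $ 1 * r = ?y $ 3 * p" "?y $ 1 * s = ?y $ 3 * q"
      using SpD[OF A, of x "axis 1 1"] SpD[OF A, of x "axis 3 1"] that
      by (simp_all add: e sform_axis) (simp_all add: symplectic_form4_def)
    have "?y $ 1 * (p * s - q * r) = p * (?y $ 1 * s) - q * (?y $ 1 * r)"
      "?y $ 3 * (p * s - q * r) = s * (?y $ 3 * p) - r * (?y $ 3 * q)"
      by (simp_all add: algebra_simps)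
    moreover have "p * (?y $ 1 * s) - q * (?y $ 1 * r) = 0" unfolding y by (simp add: mult_ac)
    moreover have "s * (?y $ 3 * p) - r * (?y $ 3 * q) = 0" unfolding y[symmetric] by (simp add: mult_ac)
    ultimately have "?y $ 1 * (p * s - q * r) = 0" "?y $ 3 * (p * s - q * r) = 0" by simp_all
    then show ?thesis using 1 by simp
  qed
  obtain a c where a: "A *v axis 2 1 = vector [0, a, 0, c]"
  proof
    show "A *v axis 2 1 = vector [0, (A *v axis 2 1) $ 2, 0, (A *v axis 2 1) $ 4]"
      using perp[of "axis 2 1"] by (simp add: vec_eq_iff[where 'b=4] forall_4 axis_nth)
  qed
  obtain b d where b: "A *v axis 4 1 = vector [0, b, 0, d]"
  proof
    show "A *v axis 4 1 = vector [0, (A *v axis 4 1) $ 2, 0, (A *v axis 4 1) $ 4]"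
      using perp[of "axis 4 1"] by (simp add: vec_eq_iff[where 'b=4] forall_4 axis_nth)
  qed
  have "A = plane_sum p q r s a b c d"
    by (rule matrix_eq_on_axes)
      (simp_all add: e a b plane_sum_vec axis_nth)
  moreover have "a * d - b * c = 1"
    using SpD[OF A, of "axis 2 1" "axis 4 1"] by (simp add: a b symplectic_form4_def axis_nth algebra_simps)
  ultimately show ?thesis using that 1 by blast
qed

section \<open>The order of Sp(4,q)\<close>

text \<open>
  Conjugation by \<open>P\<close> and its inverse \<open>Q\<close> moves counting problems at the pair \<open>(v, w)\<close> to the
  standard pair.
\<close>

lemma hyperbolic_frame:
  fixes v w :: "'k::field^4"
  assumes "sform v w = 1"
  obtains P Q where "P \<in> carrier (Sp sform)" "Q \<in> carrier (Sp sform)" "P ** Q = mat 1" "Q ** P = mat 1"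
    "P *v axis 1 1 = v" "P *v axis 3 1 = w" "Q *v v = axis 1 1" "Q *v w = axis 3 1"
proof -
  have "sform (axis 1 1) (axis 3 1 :: 'k^4) = 1" by (simp add: sform_axis axis_nth)
  then obtain P where P: "P \<in> carrier (Sp sform)" "P *v axis 1 1 = v" "P *v axis 3 1 = w"
    using Sp_transitive_on_hyperbolic_pairs[OF _ assms] by blast
  obtain Q where Q: "Q \<in> carrier (Sp sform)" "P ** Q = mat 1" "Q ** P = mat 1"
    using Sp_inverse[OF P(1)] by blast
  have "Q *v v = axis 1 1" "Q *v w = axis 3 1"
    by (simp_all add: P(2,3)[symmetric] matrix_vector_mul_assoc Q)
  then show ?thesis using that P Q by blast
qed

lemma card_conjugate:
  assumes PQ: "P ** Q = mat 1" "Q ** P = mat (1 :: 'k::field)"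
    and ST: "\<And>A. A \<in> S \<Longrightarrow> Q ** A ** P \<in> T" and TS: "\<And>A. A \<in> T \<Longrightarrow> P ** A ** Q \<in> S"
  shows "card S = card T"
proof (rule bij_betw_same_card, rule bij_betw_byWitness)
  show "\<forall>A\<in>S. P ** (Q ** A ** P) ** Q = A"
    by (metis PQ(1) matrix_mul_assoc matrix_mul_lid matrix_mul_rid)
  show "\<forall>A\<in>T. Q ** (P ** A ** Q) ** P = A"
    by (metis PQ(2) matrix_mul_assoc matrix_mul_lid matrix_mul_rid)
qed (use ST TS in auto)

lemma conjugate_square:
  assumes "P ** Q = mat (1 :: 'k::field)" "A ** A = mat t"
  shows "(Q ** A ** P) ** (Q ** A ** P) = mat t ** (Q ** P)"
proof -
  have "(Q ** A ** P) ** (Q ** A ** P) = Q ** (A ** (P ** Q) ** A) ** P"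
    by (simp only: matrix_mul_assoc)
  also have "\<dots> = Q ** mat t ** P" by (simp add: assms)
  also have "\<dots> = mat t ** (Q ** P)" by (simp add: mat_mult_commute[symmetric] matrix_mul_assoc)
  finally show ?thesis .
qed

lemma card_hyperbolic_pairs:
  "card {(v :: 'k::{field,finite}^4, w). sform v w = 1} = CARD('k) ^ 3 * (CARD('k) ^ 4 - 1)"
proof -
  let ?S = "{(v :: 'k^4, w). sform v w = 1}"
  have "card ?S = CARD('k) ^ 3 * card (UNIV - {0 :: 'k^4})"
  proof (rule card_eq_mult_card_fibres[where f=fst])
    fix v :: "'k^4" assume "v \<in> UNIV - {0}"
    then obtain y where "sform v y \<noteq> 0" using sform_nondegenerate[of v] by force
    then have "card {w. sform v w = 1} * CARD('k) = CARD('k) ^ CARD(4)"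
      by (rule card_linear_functional_fibre[rotated 2]) (simp_all add: sform_simps)
    then have "card {w. sform v w = 1} = CARD('k) ^ 3" by (simp add: eval_nat_numeral)
    moreover have "{p \<in> ?S. fst p = v} = Pair v ` {w. sform v w = 1}" by auto
    ultimately show "card {p \<in> ?S. fst p = v} = CARD('k) ^ 3" by (simp add: card_image inj_on_def)
  qed auto
  then show ?thesis by (simp add: card_Diff_subset)
qed

text \<open>
  The stabiliser of \<open>e1\<close> and \<open>e3\<close> is \<open>SL(2,q)\<close> acting on the plane of \<open>e2\<close> and \<open>e4\<close>.
\<close>

lemma card_Sp:
  "card (carrier (Sp (sform :: 'k::{field,finite}^4 \<Rightarrow> _))) =
    CARD('k) * (CARD('k) ^ 2 - 1) * (CARD('k) ^ 3 * (CARD('k) ^ 4 - 1))"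
proof -
  let ?S = "carrier (Sp (sform :: 'k^4 \<Rightarrow> _))"
  let ?e = "axis 1 1 :: 'k^4" and ?f = "axis 3 1 :: 'k^4"
  let ?F = "\<lambda>v w. {A \<in> ?S. (A *v ?e, A *v ?f) = (v, w)}"
  let ?f4 = "\<lambda>(a, b, c, d). plane_sum 1 0 0 1 a b c d :: 'k^4^4"
  have "?F ?e ?f = ?f4 ` {(a, b, c, d). a * d - b * c = 1}"
  proof safe
    fix A :: "'k^4^4" assume A: "A \<in> ?S" and e: "A *v ?e = ?e" "A *v ?f = ?f"
    have "A *v ?e = vector [1, 0, 0, 0]" "A *v ?f = vector [0, 0, 1, 0]"
      by (simp_all add: e vec_eq_iff forall_4 axis_nth)
    then obtain a b c d where "A = plane_sum 1 0 0 1 a b c d" "a * d - b * c = 1"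
      using Sp_preserving_plane[OF A] by metis
    then show "A \<in> ?f4 ` {(a, b, c, d). a * d - b * c = 1}"
      by (auto intro!: image_eqI[of _ _ "(a, b, c, d)"])
  qed (auto simp: plane_sum_Sp, auto simp: plane_sum_vec vec_eq_iff forall_4 axis_nth)
  moreover have "inj_on ?f4 {(a, b, c, d). a * d - b * c = (1 :: 'k)}"
    by (auto simp: inj_on_def plane_sum_eq_iff)
  ultimately have "card (?F ?e ?f) = card {(a, b, c, d). a * d - b * c = (1 :: 'k)}"
    by (simp only: card_image)
  then have base: "card (?F ?e ?f) = CARD('k) * (CARD('k) ^ 2 - 1)" by (simp only: card_SL2)
  have "card ?S = (CARD('k) * (CARD('k) ^ 2 - 1)) * card {(v :: 'k^4, w). sform v w = 1}"
  proof (rule card_eq_mult_card_fibres[where f="\<lambda>A. (A *v ?e, A *v ?f)"])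
    show "(A *v ?e, A *v ?f) \<in> {(v, w). sform v w = 1}" if "A \<in> ?S" for A
      by (simp add: SpD[OF that]) (simp add: sform_axis axis_nth)
  next
    fix p assume "p \<in> {(v :: 'k^4, w). sform v w = 1}"
    then obtain v w where p: "p = (v, w)" "sform v w = 1" by auto
    obtain P Q :: "'k^4^4" where PQ: "P \<in> ?S" "Q \<in> ?S" "P ** Q = mat 1" "Q ** P = mat 1"
      "P *v ?e = v" "P *v ?f = w" "Q *v v = ?e" "Q *v w = ?f"
      by (rule hyperbolic_frame[OF p(2)])
    have "Q ** A \<in> ?F ?e ?f" if "A \<in> ?F v w" for A
      using that PQ by (simp add: Sp_mult_closed flip: matrix_vector_mul_assoc)
    moreover have "P ** A \<in> ?F v w" if "A \<in> ?F ?e ?f" for A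
      using that PQ by (simp add: Sp_mult_closed flip: matrix_vector_mul_assoc)
    ultimately have "bij_betw ((**) P) (?F ?e ?f) (?F v w)"
      by (intro bij_betw_byWitness[where f'="(**) Q"]) (auto simp only: matrix_mul_assoc PQ matrix_mul_lid)
    then show "card {A \<in> ?S. (A *v ?e, A *v ?f) = p} = CARD('k) * (CARD('k) ^ 2 - 1)"
      using base p bij_betw_same_card by fastforce
  qed auto
  then show ?thesis by (simp add: card_hyperbolic_pairs)
qed

section \<open>Elements of Sp(4,3) of square minus one\<close>

lemma gf3_three: "(3 :: gf3) = 0"
  using of_nat_card_eq_0[where 'a=three] by simp

lemma gf3_two: "(2 :: gf3) = - 1"
  using gf3_three by (simp add: eq_neg_iff_add_eq_0)

lemma gf3_two_nonzero: "(2 :: gf3) \<noteq> 0"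
  by (simp add: gf3_two)

lemma gf3_one_neq: "(1 :: gf3) \<noteq> - 1" "(- 1 :: gf3) \<noteq> 1"
  using gf3_two_nonzero by (auto simp: eq_neg_iff_add_eq_0 neg_eq_iff_add_eq_0)

lemma UNIV_gf3: "(UNIV :: gf3 set) = {0, 1, - 1}"
proof -
  have "card {0, 1, - 1 :: gf3} = CARD(gf3)" using gf3_one_neq by (simp add: CARD_gf3)
  then show ?thesis by (metis card_subset_eq finite subset_UNIV)
qed

lemma gf3_cases: "x = 0 \<or> x = 1 \<or> x = (- 1 :: gf3)"
  using UNIV_gf3 by auto

lemma gf3_four: "(4 :: gf3) = 1"
  using gf3_three by (metis add_0 numeral_Bit0 numeral_Bit1 numeral_One one_add_one add.assoc)

lemmas gf3_simps = gf3_two gf3_three gf3_four gf3_one_neq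

definition sp_roots :: "'k::field \<Rightarrow> ('k^4^4) set" where
  "sp_roots t = {A \<in> carrier (Sp sform). A ** A = mat t}"

lemma sp_roots_conjugate:
  assumes "P \<in> carrier (Sp sform)" "Q \<in> carrier (Sp sform)" "P ** Q = mat 1" "Q ** P = mat 1"
    and "A \<in> sp_roots t"
  shows "Q ** A ** P \<in> sp_roots t"
  using assms conjugate_square[of P Q A t] by (simp add: sp_roots_def Sp_mult_closed)

lemma vector4_eq: "(vector [a, b, c, d] :: 'k::zero^4) = vector [a', b', c', d'] \<longleftrightarrow> a = a' \<and> b = b' \<and> c = c' \<and> d = d'"
  by (simp add: vec_eq_iff forall_4)

lemma axis_eq_vector:
  "axis 1 a = (vector [a, 0, 0, 0] :: 'k::zero^4)" "axis 3 a = (vector [0, 0, a, 0] :: 'k::zero^4)"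
  by (simp_all add: vec_eq_iff forall_4 axis_nth)

text \<open>
  The matrices \<open>(a, b; c, d)\<close> of \<open>SL(2,3)\<close> whose square is minus the identity.
\<close>

definition quarter_turns :: "(gf3 \<times> gf3 \<times> gf3 \<times> gf3) set" where
  "quarter_turns = {(0, 1, - 1, 0), (0, - 1, 1, 0), (1, 1, 1, - 1), (1, - 1, - 1, - 1),
    (- 1, 1, 1, 1), (- 1, - 1, - 1, 1)}"

lemma card_quarter_turns: "card quarter_turns = 6"
  using gf3_one_neq by (simp add: quarter_turns_def)

lemma quarter_turns_iff:
  "(a, b, c, d) \<in> quarter_turns \<longleftrightarrow>
    a * d - b * c = 1 \<and> a * a + b * c = - 1 \<and> a * b + b * d = 0 \<and> c * a + d * c = 0 \<and> c * b + d * d = - 1"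
  using gf3_cases[of a] gf3_cases[of b] gf3_cases[of c] gf3_cases[of d]
  by (elim disjE; simp add: quarter_turns_def gf3_simps)

lemma sp_roots_standard:
  "{A \<in> sp_roots (- 1 :: gf3). A *v axis 1 1 = axis 3 1} =
    (\<lambda>(a, b, c, d). plane_sum 0 (- 1) 1 0 a b c d) ` quarter_turns" (is "?L = ?R")
proof
  show "?L \<subseteq> ?R"
  proof
    fix A assume "A \<in> ?L"
    then have A: "A \<in> carrier (Sp sform)" "A ** A = mat (- 1)" "A *v axis 1 1 = axis 3 1"
      by (auto simp: sp_roots_def)
    have "A *v axis 3 1 = (A ** A) *v axis 1 1" by (simp add: A(3)[symmetric] matrix_vector_mul_assoc)
    then have "A *v axis 3 1 = vector [- 1, 0, 0, 0]"
      by (simp add: A(2) mat_vec vec_eq_iff[where 'b=4] forall_4 axis_nth)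
    moreover have "A *v axis 1 1 = vector [0, 0, 1, 0]" unfolding A(3) by (rule axis_eq_vector)
    ultimately obtain a b c d where M: "A = plane_sum 0 (- 1) 1 0 a b c d" "a * d - b * c = 1"
      using Sp_preserving_plane[OF A(1)] by metis
    then have "(a, b, c, d) \<in> quarter_turns"
      using A(2) by (simp add: plane_sum_mult mat_eq_plane_sum plane_sum_eq_iff quarter_turns_iff)
    then show "A \<in> ?R" using M(1) by (auto intro!: image_eqI[of _ _ "(a, b, c, d)"])
  qed
  show "?R \<subseteq> ?L"
    by (auto simp: quarter_turns_iff sp_roots_def plane_sum_Sp plane_sum_mult mat_eq_plane_sum
        plane_sum_eq_iff plane_sum_vec axis_eq_vector vector4_eq)
qed

lemma card_vec4:
  "card {x :: 'k::{finite,zero}^4. R x} =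
    (\<Sum>p\<in>UNIV. \<Sum>q\<in>UNIV. \<Sum>r\<in>UNIV. \<Sum>s\<in>UNIV. if R (vector [p, q, r, s]) then 1 else 0)"
proof -
  let ?f = "\<lambda>(p, q, r, s). vector [p, q, r, s] :: 'k^4"
  have "bij_betw ?f UNIV UNIV"
    by (rule bij_betw_byWitness[where f'="\<lambda>x. (x$1, x$2, x$3, x$4)"])
      (auto simp: vec_eq_iff forall_4)
  then have "(\<Sum>x\<in>UNIV. if R x then 1 else 0 :: nat) = (\<Sum>y\<in>UNIV. if R (?f y) then 1 else 0)"
    by (rule sum.reindex_bij_betw[symmetric])
  also have "\<dots> = (\<Sum>p\<in>UNIV. \<Sum>q\<in>UNIV. \<Sum>r\<in>UNIV. \<Sum>s\<in>UNIV. if R (vector [p, q, r, s]) then 1 else 0)"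
    by (simp add: sum.cartesian_product UNIV_Times_UNIV[symmetric] split_def del: UNIV_Times_UNIV)
  also have "(\<Sum>x\<in>UNIV. if R x then 1 else 0 :: nat) = card {x. R x}"
    by (simp add: sum.If_cases)
  finally show ?thesis .
qed

lemma sum_UNIV_gf3: "(\<Sum>x\<in>UNIV. f x) = f 0 + f 1 + f (- 1 :: gf3)"
  unfolding UNIV_gf3 using gf3_one_neq by (simp add: add.assoc)

text \<open>
  A quadratic form in four variables over the field with three elements: 81 values for each of
  the six matrices.
\<close>

lemma card_unit_vectors_standard:
  assumes "(a, b, c, d) \<in> quarter_turns"
  shows "card {x. sform x (plane_sum 0 (- 1) 1 0 a b c d *v x) = 1} = 24"
proof -
  have "sform (vector [p, q, r, s]) (plane_sum 0 (- 1) 1 0 a b c d *v vector [p, q, r, s])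
      = p * p + r * r + (c * (q * q) + (d - a) * (q * s) - b * (s * s))" for p q r s
    by (simp add: plane_sum_vec symplectic_form4_def algebra_simps)
  then have "card {x. sform x (plane_sum 0 (- 1) 1 0 a b c d *v x) = 1} =
    (\<Sum>p\<in>UNIV. \<Sum>q\<in>UNIV. \<Sum>r\<in>UNIV. \<Sum>s\<in>UNIV.
      if p * p + r * r + (c * (q * q) + (d - a) * (q * s) - b * (s * s)) = 1 then 1 else 0)"
    by (simp add: card_vec4)
  also have "\<dots> = 24"
    using assms unfolding quarter_turns_def insert_iff empty_iff prod.inject
    by (elim disjE conjE; simp only: refl; simp add: sum_UNIV_gf3 gf3_simps)
  finally show ?thesis .
qed

lemma matrix_vector_minus: "A *v (- x) = - (A *v (x :: 'k::field^'n))"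
  using vector_scalar_commute[of A "- 1" x] by simp

lemma mat_minus_one_vec: "mat (- 1) *v x = - (x :: 'k::field^'n)"
  by (simp add: mat_vec)

text \<open>
  For \<open>A * A = -1\<close> the form \<open>sform x (A y)\<close> is symmetric and nondegenerate, so it has a value
  \<open>sform v (A v)\<close> that is \<open>1\<close> or \<open>-1\<close>; passing from \<open>v\<close> to \<open>v + A v\<close> doubles it, i.e. changes
  its sign.
\<close>

lemma sp_root_minus_one_frame:
  assumes A: "A \<in> sp_roots (- 1 :: gf3)"
  obtains v where "sform v (A *v v) = 1"
proof -
  have AS: "A \<in> carrier (Sp sform)" and sq: "A *v (A *v x) = - x" for x
    using A by (simp_all add: sp_roots_def matrix_vector_mul_assoc mat_minus_one_vec)
  have sym: "sform x (A *v y) = sform y (A *v x)" for x y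
    using SpD[OF AS, of x "A *v y"] sform_skew[of "A *v x" y] by (simp add: sq sform_minus)
  have "\<exists>v. sform v (A *v v) \<noteq> 0"
  proof (rule ccontr)
    assume no: "\<not> ?thesis"
    have "sform x (A *v y) = 0" for x y
    proof -
      have "sform (x + y) (A *v (x + y)) = 2 * sform x (A *v y)"
        using no sym[of y x] by (simp add: matrix_vector_right_distrib sform_simps)
      then show ?thesis using no gf3_two_nonzero by simp
    qed
    moreover have "sform (axis 1 1) (A *v (- (A *v axis 3 1))) = 1"
      using sq[of "axis 3 1"] by (simp add: matrix_vector_minus sform_axis axis_nth)
    ultimately show False by simp
  qed
  then obtain v where "sform v (A *v v) \<noteq> 0" by blast
  then consider "sform v (A *v v) = 1" | "sform v (A *v v) = - 1" using gf3_cases by blast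
  then show ?thesis
  proof cases
    case 2
    have "sform (v + A *v v) (A *v (v + A *v v)) = sform v (A *v v) + sform v (A *v v)"
      using sform_skew[of "A *v v" v] by (simp add: matrix_vector_right_distrib sq sform_simps)
    then have "sform (v + A *v v) (A *v (v + A *v v)) = 1" by (simp add: 2 gf3_simps)
    then show ?thesis by (rule that)
  qed (rule that)
qed

text \<open>
  Pairs of \<open>A\<close> and \<open>v\<close> with \<open>sform v (A v) = 1\<close> are counted in two ways. For a given \<open>A\<close> there
  are 24 vectors \<open>v\<close>. For a given hyperbolic pair \<open>(v, A v)\<close> the matrix \<open>A\<close> is determined on
  the plane, and is a quarter turn of the orthogonal complement.
\<close>

lemma card_sp_roots_minus_one: "card (sp_roots (- 1 :: gf3)) = 540"
proof -
  let ?S = "sp_roots (- 1 :: gf3)"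
  let ?P = "{(A, v). A \<in> ?S \<and> sform v (A *v v) = 1}"
  have "card ?P = 24 * card ?S"
  proof (rule card_eq_mult_card_fibres[where f=fst])
    fix A assume A: "A \<in> ?S"
    obtain v where v: "sform v (A *v v) = 1" by (rule sp_root_minus_one_frame[OF A])
    obtain P Q where PQ: "P \<in> carrier (Sp sform)" "Q \<in> carrier (Sp sform)" "P ** Q = mat 1" "Q ** P = mat 1"
      "P *v axis 1 1 = v" "P *v axis 3 1 = A *v v" "Q *v v = axis 1 1" "Q *v (A *v v) = axis 3 1"
      by (rule hyperbolic_frame[OF v])
    have "Q ** A ** P \<in> ?S" by (rule sp_roots_conjugate[OF PQ(1-4) A])
    moreover have "(Q ** A ** P) *v axis 1 1 = axis 3 1"
      by (simp add: PQ(5,8) flip: matrix_vector_mul_assoc)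
    ultimately have "Q ** A ** P \<in> (\<lambda>(a, b, c, d). plane_sum 0 (- 1) 1 0 a b c d) ` quarter_turns"
      unfolding sp_roots_standard[symmetric] by simp
    then have base: "card {x. sform x ((Q ** A ** P) *v x) = 1} = 24"
      using card_unit_vectors_standard by auto
    have eq: "sform x ((Q ** A ** P) *v x) = sform (P *v x) (A *v (P *v x))" for x
    proof -
      have "sform x ((Q ** A ** P) *v x) = sform (P *v x) (P *v (Q *v (A *v (P *v x))))"
        by (simp add: SpD[OF PQ(1)] flip: matrix_vector_mul_assoc)
      then show ?thesis by (simp add: matrix_vector_mul_assoc PQ(3) matrix_mul_assoc)
    qed
    have PQv: "P *v (Q *v x) = x" "Q *v (P *v x) = x" for x
      by (simp_all add: matrix_vector_mul_assoc PQ(3,4))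
    have "bij_betw ((*v) P) {x. sform x ((Q ** A ** P) *v x) = 1} {v. sform v (A *v v) = 1}"
      unfolding eq
      by (rule bij_betw_byWitness[where f'="(*v) Q"])
        (auto simp: PQv)
    then have "card {v. sform v (A *v v) = 1} = 24" using base bij_betw_same_card by fastforce
    moreover have "{p \<in> ?P. fst p = A} = Pair A ` {v. sform v (A *v v) = 1}" using A by auto
    ultimately show "card {p \<in> ?P. fst p = A} = 24" by (simp add: card_image inj_on_def)
  qed auto
  moreover have "card ?P = 6 * card {(v :: gf3^4, w). sform v w = 1}"
  proof (rule card_eq_mult_card_fibres[where f="\<lambda>(A, v). (v, A *v v)"])
    fix p assume "p \<in> {(v :: gf3^4, w). sform v w = 1}"
    then obtain v w where p: "p = (v, w)" "sform v w = 1" by auto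
    obtain P Q where PQ: "P \<in> carrier (Sp sform)" "Q \<in> carrier (Sp sform)" "P ** Q = mat 1" "Q ** P = mat 1"
      "P *v axis 1 1 = v" "P *v axis 3 1 = w" "Q *v v = axis 1 1" "Q *v w = axis 3 1"
      by (rule hyperbolic_frame[OF p(2)])
    have "card {A \<in> ?S. A *v v = w} = card {A \<in> ?S. A *v axis 1 1 = axis 3 1}"
      by (rule card_conjugate[OF PQ(3,4)])
        (use sp_roots_conjugate[OF PQ(1-4)] sp_roots_conjugate[OF PQ(2,1,4,3)]
          in \<open>simp_all add: PQ(5-8) flip: matrix_vector_mul_assoc\<close>)
    also have "\<dots> = card quarter_turns"
      unfolding sp_roots_standard
      by (rule card_image) (auto simp: inj_on_def plane_sum_eq_iff)
    also have "\<dots> = 6" by (rule card_quarter_turns)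
    finally have "card {A \<in> ?S. A *v v = w} = 6" .
    moreover have "{x \<in> ?P. (case x of (A, v) \<Rightarrow> (v, A *v v)) = p} = (\<lambda>A. (A, v)) ` {A \<in> ?S. A *v v = w}"
      using p by auto
    ultimately show "card {x \<in> ?P. (case x of (A, v) \<Rightarrow> (v, A *v v)) = p} = 6"
      by (simp add: card_image inj_on_def)
  qed auto
  ultimately show ?thesis by (simp add: card_hyperbolic_pairs)
qed

section \<open>Elements of Sp(4,3) of square one\<close>

definition sp_involutions :: "(gf3^4^4) set" where
  "sp_involutions = sp_roots 1 - {mat 1, mat (- 1)}"

lemma conjugate_mat:
  assumes "Q ** P = mat (1 :: 'k::field)" shows "Q ** mat t ** P = mat t"
  unfolding mat_mult_commute[of t Q, symmetric] by (simp add: assms flip: matrix_mul_assoc)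

lemma sp_involutions_conjugate:
  assumes PQ: "P \<in> carrier (Sp sform)" "Q \<in> carrier (Sp sform)" "P ** Q = mat 1" "Q ** P = mat 1"
    and A: "A \<in> sp_involutions"
  shows "Q ** A ** P \<in> sp_involutions"
proof -
  have "A = P ** (Q ** A ** P) ** Q"
    by (metis PQ(3) matrix_mul_assoc matrix_mul_lid matrix_mul_rid)
  then have "Q ** A ** P \<noteq> mat t" if "A \<noteq> mat t" for t
    using conjugate_mat[OF PQ(3), of t] that by metis
  then show ?thesis using A sp_roots_conjugate[OF PQ] by (simp add: sp_involutions_def)
qed

lemma sp_involutions_standard:
  "{A \<in> sp_involutions. A *v axis 1 1 = axis 1 1 \<and> A *v axis 3 1 = axis 3 1} =
    {plane_sum 1 0 0 1 (- 1) 0 0 (- 1)}"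
proof -
  have "A = plane_sum 1 0 0 1 (- 1) 0 0 (- 1)"
    if "A \<in> sp_involutions" "A *v axis 1 1 = axis 1 1" "A *v axis 3 1 = axis 3 1" for A
  proof -
    have A: "A \<in> carrier (Sp sform)" "A ** A = mat 1" "A \<noteq> mat 1"
      using that by (auto simp: sp_involutions_def sp_roots_def)
    have "A *v axis 1 1 = vector [1, 0, 0, 0]" "A *v axis 3 1 = vector [0, 0, 1, 0]"
      unfolding that by (rule axis_eq_vector)+
    then obtain a b c d where M: "A = plane_sum 1 0 0 1 a b c d" "a * d - b * c = 1"
      using Sp_preserving_plane[OF A(1)] by metis
    have "a * a + b * c = 1" "a * b + b * d = 0" "c * a + d * c = 0" "c * b + d * d = 1"
      "\<not> (a = 1 \<and> b = 0 \<and> c = 0 \<and> d = 1)"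
      using A(2,3) by (simp_all add: M plane_sum_mult mat_eq_plane_sum plane_sum_eq_iff)
    then have "a = - 1 \<and> b = 0 \<and> c = 0 \<and> d = - 1"
      using M(2) gf3_cases[of a] gf3_cases[of b] gf3_cases[of c] gf3_cases[of d]
      by (elim disjE; simp add: gf3_simps)
    then show ?thesis by (simp add: M)
  qed
  moreover have "plane_sum 1 0 0 1 (- 1) 0 0 (- 1) \<in> sp_involutions"
    using gf3_one_neq
    by (simp add: sp_involutions_def sp_roots_def plane_sum_Sp plane_sum_mult mat_eq_plane_sum plane_sum_eq_iff)
  moreover have "plane_sum 1 0 0 1 (- 1) 0 0 (- 1 :: gf3) *v axis 1 1 = axis 1 1"
    "plane_sum 1 0 0 1 (- 1) 0 0 (- 1 :: gf3) *v axis 3 1 = axis 3 1"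
    by (simp_all add: plane_sum_vec vec_eq_iff[where 'b=4] forall_4 axis_nth)
  ultimately show ?thesis by blast
qed

text \<open>
  The vectors \<open>y + A y\<close> are fixed by \<open>A\<close>, and \<open>sform v (y + A y)\<close> is twice \<open>sform v y\<close>, i.e.
  \<open>- sform v y\<close>, if \<open>v\<close> is fixed.
\<close>

lemma sp_involution_frame:
  assumes A: "A \<in> sp_involutions"
  obtains v w where "sform v w = 1" "A *v v = v" "A *v w = w"
proof -
  have AS: "A \<in> carrier (Sp sform)" and sq: "A *v (A *v x) = x" for x
    using A by (simp_all add: sp_involutions_def sp_roots_def matrix_vector_mul_assoc)
  have "A \<noteq> mat (- 1)" using A by (simp add: sp_involutions_def)
  then obtain u where u: "A *v u \<noteq> - u"
    by (auto simp: matrix_eq mat_minus_one_vec)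
  define v where "v = u + A *v u"
  have "v \<noteq> 0" using u by (auto simp: v_def add_eq_0_iff)
  have Av: "A *v v = v" by (simp add: v_def matrix_vector_right_distrib sq add.commute)
  obtain y where y: "sform v y = 1" using sform_nondegenerate[OF \<open>v \<noteq> 0\<close>] by blast
  have "sform v (A *v y) = 1" using SpD[OF AS, of v y] by (simp add: Av y)
  then have "sform v (- (y + A *v y)) = 1" by (simp add: sform_simps y gf3_simps)
  moreover have "A *v (- (y + A *v y)) = - (y + A *v y)"
    by (simp add: matrix_vector_minus matrix_vector_mult_diff_distrib sq)
  ultimately show ?thesis using that Av by blast
qed

text \<open>
  Pairs of \<open>A\<close> and a hyperbolic pair of vectors fixed by \<open>A\<close> are counted in two ways. The
  fixed vectors of \<open>A\<close> form a hyperbolic plane, which contains as many hyperbolic pairs as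
  \<open>SL(2,3)\<close> has elements; and \<open>A\<close> is the identity on that plane and minus the identity on its
  complement.
\<close>

lemma card_sp_involutions: "card sp_involutions = 90"
proof -
  let ?S = "sp_involutions"
  let ?fix = "\<lambda>A. {(v, w). sform v w = 1 \<and> A *v v = v \<and> A *v w = w}"
  let ?P = "{(A, p). A \<in> ?S \<and> p \<in> ?fix A}"
  have "card ?P = 24 * card ?S"
  proof (rule card_eq_mult_card_fibres[where f=fst])
    fix A assume A: "A \<in> ?S"
    obtain v w where vw: "sform v w = 1" "A *v v = v" "A *v w = w" by (rule sp_involution_frame[OF A])
    obtain P Q where PQ: "P \<in> carrier (Sp sform)" "Q \<in> carrier (Sp sform)" "P ** Q = mat 1" "Q ** P = mat 1"
      "P *v axis 1 1 = v" "P *v axis 3 1 = w" "Q *v v = axis 1 1" "Q *v w = axis 3 1"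
      by (rule hyperbolic_frame[OF vw(1)])
    define B where "B = Q ** A ** P"
    have "B \<in> ?S" unfolding B_def by (rule sp_involutions_conjugate[OF PQ(1-4) A])
    moreover have "B *v axis 1 1 = axis 1 1" "B *v axis 3 1 = axis 3 1"
      by (simp_all add: B_def PQ(5-8) vw flip: matrix_vector_mul_assoc)
    ultimately have B: "B = plane_sum 1 0 0 1 (- 1) 0 0 (- 1)" using sp_involutions_standard by auto
    have "?fix B = (\<lambda>(a, b, c, d). (vector [a, 0, b, 0], vector [c, 0, d, 0])) ` {(a, b, c, d). a * d - b * c = 1}"
      (is "_ = ?f ` ?D")
    proof safe
      fix x y assume xy: "sform x y = 1" "B *v x = x" "B *v y = y"
      have half: "t = 0" if "- t = t" for t :: gf3 using that gf3_cases[of t] gf3_one_neq by auto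
      have fixed: "z $ 2 = 0 \<and> z $ 4 = 0" if "B *v z = z" for z
        using arg_cong[OF that, of "\<lambda>z. z $ 2"] arg_cong[OF that, of "\<lambda>z. z $ 4"]
        by (simp add: B plane_sum_vec half)
      have 0: "x $ 2 = 0" "x $ 4 = 0" "y $ 2 = 0" "y $ 4 = 0" using fixed xy(2,3) by auto
      then have "x = vector [x$1, 0, x$3, 0]" "y = vector [y$1, 0, y$3, 0]"
        by (simp_all add: vec_eq_iff[where 'b=4] forall_4)
      moreover have "x$1 * y$3 - x$3 * y$1 = 1"
        using xy(1) by (simp add: symplectic_form4_def 0)
      ultimately show "(x, y) \<in> ?f ` ?D" by (auto intro!: image_eqI[of _ _ "(x$1, x$3, y$1, y$3)"])
    qed (auto simp: B symplectic_form4_def plane_sum_vec)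
    moreover have "inj_on ?f ?D" by (auto simp: inj_on_def vector4_eq)
    ultimately have "card (?fix B) = card {(a, b, c, d). a * d - b * c = (1 :: gf3)}"
      by (simp only: card_image)
    then have base: "card (?fix B) = 24" by (simp add: card_SL2)
    have PB: "P *v (B *v x) = A *v (P *v x)" for x
      by (simp add: B_def matrix_vector_mul_assoc matrix_mul_assoc PQ(3))
    have QA: "Q *v (A *v x) = B *v (Q *v x)" for x
      by (simp add: B_def matrix_vector_mul_assoc PQ(3) flip: matrix_mul_assoc)
    have "bij_betw (\<lambda>(x, y). (P *v x, P *v y)) (?fix B) (?fix A)"
    proof (rule bij_betw_byWitness[where f'="\<lambda>(x, y). (Q *v x, Q *v y)"])
      show "(\<lambda>(x, y). (P *v x, P *v y)) ` ?fix B \<subseteq> ?fix A"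
        by (auto simp: SpD[OF PQ(1)] simp flip: PB)
      show "(\<lambda>(x, y). (Q *v x, Q *v y)) ` ?fix A \<subseteq> ?fix B"
        by (auto simp: SpD[OF PQ(2)] simp flip: QA)
    qed (auto simp: matrix_vector_mul_assoc PQ(3,4))
    then have "card (?fix A) = 24" using base bij_betw_same_card by fastforce
    moreover have "{p \<in> ?P. fst p = A} = Pair A ` ?fix A" using A by auto
    ultimately show "card {p \<in> ?P. fst p = A} = 24" by (simp add: card_image inj_on_def)
  qed auto
  moreover have "card ?P = 1 * card {(v :: gf3^4, w). sform v w = 1}"
  proof (rule card_eq_mult_card_fibres[where f=snd])
    fix p assume "p \<in> {(v :: gf3^4, w). sform v w = 1}"
    then obtain v w where p: "p = (v, w)" "sform v w = 1" by auto
    obtain P Q where PQ: "P \<in> carrier (Sp sform)" "Q \<in> carrier (Sp sform)" "P ** Q = mat 1" "Q ** P = mat 1"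
      "P *v axis 1 1 = v" "P *v axis 3 1 = w" "Q *v v = axis 1 1" "Q *v w = axis 3 1"
      by (rule hyperbolic_frame[OF p(2)])
    have "card {A \<in> ?S. A *v v = v \<and> A *v w = w} =
        card {A \<in> ?S. A *v axis 1 1 = axis 1 1 \<and> A *v axis 3 1 = axis 3 1}"
      by (rule card_conjugate[OF PQ(3,4)])
        (use sp_involutions_conjugate[OF PQ(1-4)] sp_involutions_conjugate[OF PQ(2,1,4,3)]
          in \<open>simp_all add: PQ(5-8) flip: matrix_vector_mul_assoc\<close>)
    also have "\<dots> = 1" unfolding sp_involutions_standard by simp
    finally have "card {A \<in> ?S. A *v v = v \<and> A *v w = w} = 1" .
    moreover have "{x \<in> ?P. snd x = p} = (\<lambda>A. (A, p)) ` {A \<in> ?S. A *v v = v \<and> A *v w = w}"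
      using p by auto
    ultimately show "card {x \<in> ?P. snd x = p} = 1" by (simp add: card_image inj_on_def)
  qed auto
  ultimately show ?thesis by (simp add: card_hyperbolic_pairs)
qed

section \<open>The group PSp(4,3), and the counterexample\<close>

lemma PSp4_gf3:
  "simple_group (PSp (symplectic_form4 :: gf3^4 \<Rightarrow> gf3^4 \<Rightarrow> gf3))"
  "order (PSp (symplectic_form4 :: gf3^4 \<Rightarrow> gf3^4 \<Rightarrow> gf3)) = 25920"
  "I2 (PSp (symplectic_form4 :: gf3^4 \<Rightarrow> gf3^4 \<Rightarrow> gf3)) = 315"
proof -
  let ?G = "Sp (symplectic_form4 :: gf3^4 \<Rightarrow> gf3^4 \<Rightarrow> gf3)" and ?Z = "{mat 1, mat (- 1)} :: (gf3^4^4) set"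
  interpret group ?G by (rule group_Sp)
  have Z: "group_center ?G = ?Z" by (rule group_center_Sp[OF gf3_two_nonzero])
  have cZ: "card ?Z = 2" using gf3_one_neq by (simp add: mat_inj)
  interpret normal ?Z ?G using group_center_normal unfolding Z .
  have PSp: "PSp symplectic_form4 = ?G Mod ?Z" by (simp add: PSp_def Z)
  have fin: "finite (carrier ?G)" by simp
  have ord: "order ?G = 51840" using card_Sp[where 'k=gf3] by (simp add: order_def)
  have "?Z \<noteq> carrier ?G" using ord cZ by (auto simp: order_def)
  then show "simple_group (PSp (symplectic_form4 :: gf3^4 \<Rightarrow> gf3^4 \<Rightarrow> gf3))"
    unfolding PSp using Sp_normal_subgroup[OF gf3_two_nonzero] unfolding Z
    by (intro simple_FactGroup fin) auto
  show "order (PSp (symplectic_form4 :: gf3^4 \<Rightarrow> gf3^4 \<Rightarrow> gf3)) = 25920"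
    using order_FactGroup by (simp add: ord cZ PSp)
  have "{A \<in> carrier ?G. A \<notin> ?Z \<and> A \<otimes>\<^bsub>?G\<^esub> A \<in> ?Z} = sp_involutions \<union> sp_roots (- 1)"
    using gf3_one_neq by (auto simp: sp_involutions_def sp_roots_def mat_mult_mat mat_inj)
  moreover have "sp_involutions \<inter> sp_roots (- 1) = {}"
    using gf3_one_neq by (auto simp: sp_involutions_def sp_roots_def mat_inj)
  ultimately have "card {A \<in> carrier ?G. A \<notin> ?Z \<and> A \<otimes>\<^bsub>?G\<^esub> A \<in> ?Z} = 630"
    by (simp add: card_Un_disjoint card_sp_involutions card_sp_roots_minus_one)
  then show "I2 (PSp (symplectic_form4 :: gf3^4 \<Rightarrow> gf3^4 \<Rightarrow> gf3)) = 315"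
    using I2_FactGroup_mult[OF fin] by (simp add: cZ PSp)
qed

theorem mainTheorem1:
  shows "simple_group (PSp (symplectic_form4 :: gf3^4 \<Rightarrow> gf3^4 \<Rightarrow> gf3))
    \<and> simple_group (PSL :: (gf4^3^3) set monoid)
    \<and> I2 (PSp (symplectic_form4 :: gf3^4 \<Rightarrow> gf3^4 \<Rightarrow> gf3)) = 315
    \<and> I2 (PSL :: (gf4^3^3) set monoid) = 315
    \<and> order (PSp (symplectic_form4 :: gf3^4 \<Rightarrow> gf3^4 \<Rightarrow> gf3)) = 25920
    \<and> order (PSL :: (gf4^3^3) set monoid) = 20160
    \<and> \<not> (\<forall>(G :: nat monoid) (H :: nat monoid).
          simple_group G \<and> finite (carrier G) \<and> simple_group H \<and> finite (carrier H)
          \<and> I2 G = I2 H \<longrightarrow> order G = order H)"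
proof -
  let ?P = "PSp (symplectic_form4 :: gf3^4 \<Rightarrow> gf3^4 \<Rightarrow> gf3)" and ?L = "PSL :: (gf4^3^3) set monoid"
  have fin: "finite (carrier ?P)" "finite (carrier ?L)"
    using PSp4_gf3(2) PSL3_gf4(2) by (auto simp: order_def intro: card_ge_0_finite)
  obtain G :: "nat monoid" where G: "simple_group G" "finite (carrier G)" "I2 G = I2 ?P" "order G = order ?P"
    by (rule simple_group.nat_copy[OF PSp4_gf3(1) fin(1)])
  obtain H :: "nat monoid" where H: "simple_group H" "finite (carrier H)" "I2 H = I2 ?L" "order H = order ?L"
    by (rule simple_group.nat_copy[OF PSL3_gf4(1) fin(2)])
  have "I2 G = I2 H" "order G \<noteq> order H"
    using G H PSp4_gf3 PSL3_gf4 by simp_all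
  then show ?thesis using G H PSp4_gf3 PSL3_gf4 by blast
qed

end
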